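(* Let $x_1,\dots,x_n\in\mathbb{R}^d$ and $X=\mathrm{conv}\{\pm x_1,\dots,\pm x_n\}$. Let $r>0$ be such that $r\cdot B_2^d\subseteq X$ and let $R=\max_t\|x_t\|$. Let $\mathcal{E}_n$ be the output of the scale-dependent streaming algorithm described in the context. Then for every origin-centered ellipsoid $\mathcal{E}^*\supseteq X$ with aspect ratio at most $R/r$, $$\mathcal{E}_n\subseteq \alpha\cdot\mathcal{E}^*,\qquad\text{where } \alpha=O\Big(\sqrt{d\,(\log(R/r)+1)}\Big)$$ (with an absolute constant in the $O$). Moreover, the algorithm runs in time $O(nd^2)$ and stores at most $O(d^2)$ floating point numbers.
   Context: $B_2^d$ is the Euclidean unit ball; all ellipsoids are centered at the origin. The aspect ratio of an ellipsoid is the ratio of its longest to its shortest semi-axis. Scale-dependent algorithm: it receives the points $x_1,\dots,x_n$ one at a time and the value $r$; it initializes $\mathcal{E}_0=r\cdot B_2^d$ and, for $t=1,\dots,n$, upon reading $x_t$ sets $\mathcal{E}_t$ to be the origin-centered ellipsoid of smallest volume containing both $\mathcal{E}_{t-1}$ and $x_t$; it outputs $\mathcal{E}_n$. The ellipsoid $\mathcal{E}_t$ is stored as a matrix $A_t$ with $\mathcal{E}_t=\{x:\|A_tx\|\le 1\}$, $A_0=\frac1r I$, and updated by: if $\|A_{t-1}x_t\|\le 1$ then $A_t=A_{t-1}$, otherwise $A_t=\Big(I-\big(1-\frac{1}{\|A_{t-1}x_t\|}\big)\frac{(A_{t-1}x_t)(A_{t-1}x_t)^T}{\|A_{t-1}x_t\|^2}\Big)A_{t-1}$.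 *)

theory Defs
  imports
    "HOL-Analysis.Lebesgue_Measure"
    "Jordan_Normal_Form.Determinant"
begin

(* The absolute constants have to be chosen before the dimension d, so R^d is the set
   "carrier_vec d" of the dimension-carrying vectors of Jordan_Normal_Form rather than a type. *)

no_notation inner (infix \<open>\<bullet>\<close> 70)

definition enorm :: "real vec \<Rightarrow> real" where
  "enorm v = sqrt (v \<bullet> v)"

definition euclid_ball :: "nat \<Rightarrow> real \<Rightarrow> real vec set" where
  "euclid_ball d r = {v \<in> carrier_vec d. enorm v \<le> r}"

definition dilate :: "real \<Rightarrow> real vec set \<Rightarrow> real vec set" where
  "dilate c S = (\<lambda>v. c \<cdot>\<^sub>v v) ` S"

definition conv_hull :: "nat \<Rightarrow> real vec set \<Rightarrow> real vec set" where
  "conv_hull d S =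
     {vec d (\<lambda>i. \<Sum>v\<in>F. c v * v $ i) | F c.
        finite F \<and> F \<subseteq> S \<and> (\<forall>v\<in>F. 0 \<le> c v) \<and> (\<Sum>v\<in>F. c v) = (1::real)}"

(* d-dimensional Lebesgue measure, transported along f |-> (f 0, ..., f (d-1)). *)
definition volume :: "nat \<Rightarrow> real vec set \<Rightarrow> ennreal" where
  "volume d S =
     (let M = (\<Pi>\<^sub>M i\<in>{..<d}. (lborel :: real measure))
      in emeasure M {f \<in> space M. vec d f \<in> S})"

definition mat_ellipsoid :: "nat \<Rightarrow> real mat \<Rightarrow> real vec set" where
  "mat_ellipsoid d A = {v \<in> carrier_vec d. enorm (A *\<^sub>v v) \<le> 1}"

(* Ellipsoids are nondegenerate and centered at the origin. *)
definition ellipsoid :: "nat \<Rightarrow> real vec set \<Rightarrow> bool" where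
  "ellipsoid d E \<longleftrightarrow> (\<exists>A \<in> carrier_mat d d. det A \<noteq> 0 \<and> E = mat_ellipsoid d A)"

(* E has semi-axes of lengths a 0, ..., a (d-1) in the orthonormal directions u 0, ..., u (d-1). *)
definition has_semi_axes ::
    "nat \<Rightarrow> real vec set \<Rightarrow> (nat \<Rightarrow> real vec) \<Rightarrow> (nat \<Rightarrow> real) \<Rightarrow> bool" where
  "has_semi_axes d E u a \<longleftrightarrow>
     (\<forall>i<d. u i \<in> carrier_vec d) \<and>
     (\<forall>i<d. \<forall>j<d. u i \<bullet> u j = (if i = j then 1 else 0)) \<and>
     (\<forall>i<d. 0 < a i) \<and>
     E = {v \<in> carrier_vec d. (\<Sum>i<d. ((u i \<bullet> v) / a i)\<^sup>2) \<le> 1}"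

(* Every ellipsoid has semi-axes (singular value decomposition), and their lengths are unique
   up to order, so for d > 0 this relates each ellipsoid to exactly one number. *)
definition has_aspect_ratio :: "nat \<Rightarrow> real vec set \<Rightarrow> real \<Rightarrow> bool" where
  "has_aspect_ratio d E \<kappa> \<longleftrightarrow>
     (\<exists>u a. has_semi_axes d E u a \<and> \<kappa> = Max (a ` {..<d}) / Min (a ` {..<d}))"

definition min_volume_ellipsoid :: "nat \<Rightarrow> real vec set \<Rightarrow> real vec set \<Rightarrow> bool" where
  "min_volume_ellipsoid d S E \<longleftrightarrow>
     ellipsoid d E \<and> S \<subseteq> E \<and>
     (\<forall>F. ellipsoid d F \<and> S \<subseteq> F \<longrightarrow> volume d E \<le> volume d F)"

(* The input points are x 1, ..., x n. *)
definition scale_dep_run ::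
    "nat \<Rightarrow> real \<Rightarrow> (nat \<Rightarrow> real vec) \<Rightarrow> nat \<Rightarrow> (nat \<Rightarrow> real vec set) \<Rightarrow> bool" where
  "scale_dep_run d r x n E \<longleftrightarrow>
     E 0 = euclid_ball d r \<and>
     (\<forall>t\<in>{1..n}. min_volume_ellipsoid d (insert (x t) (E (t - 1))) (E t))"

definition update_matrix :: "nat \<Rightarrow> real mat \<Rightarrow> real vec \<Rightarrow> real mat" where
  "update_matrix d A v =
     (let y = A *\<^sub>v v in
      if enorm y \<le> 1 then A
      else (1\<^sub>m d - (1 - 1 / enorm y) \<cdot>\<^sub>m mat d d (\<lambda>(i, j). y $ i * y $ j / (enorm y)\<^sup>2)) * A)"

fun scale_dep_matrix :: "nat \<Rightarrow> real \<Rightarrow> (nat \<Rightarrow> real vec) \<Rightarrow> nat \<Rightarrow> real mat" where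
  "scale_dep_matrix d r x 0 = (1 / r) \<cdot>\<^sub>m 1\<^sub>m d"
| "scale_dep_matrix d r x (Suc t) = update_matrix d (scale_dep_matrix d r x t) (x (Suc t))"

(* A small imperative language whose memory consists of named arrays of real cells and whose
   control uses natural-number index variables.  Every operation, literal, variable and cell
   access, comparison, tape read and loop iteration takes one step; all real and index
   operations, sqrt included, have unit cost.  "cells" collects all memory cells ever
   accessed, so its cardinality is the number of real numbers stored. *)

type_synonym cell = "string \<times> nat"

datatype iexp =
    IConst nat
  | IVar string
  | IAdd iexp iexp
  | IMul iexp iexp

datatype rexp =
    Const real
  | Cell string iexp
  | Add rexp rexp
  | Sub rexp rexp
  | Mul rexp rexp
  | Div rexp rexp
  | Sqrt rexp

datatype com =
    Skip
  | Assign string iexp rexp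
  | Read string iexp
  | Seq com com (infixr \<open>;;\<close> 60)
  | IfLe rexp rexp com com
  | For string iexp com  (* index variable running from 0 below the bound *)

record ram =
  idx :: "string \<Rightarrow> nat"
  mem :: "cell \<Rightarrow> real"
  tape :: "real list"
  steps :: nat
  cells :: "cell set"

primrec ival :: "iexp \<Rightarrow> ram \<Rightarrow> nat" where
  "ival (IConst k) s = k"
| "ival (IVar i) s = idx s i"
| "ival (IAdd e f) s = ival e s + ival f s"
| "ival (IMul e f) s = ival e s * ival f s"

primrec icost :: "iexp \<Rightarrow> nat" where
  "icost (IConst k) = 1"
| "icost (IVar i) = 1"
| "icost (IAdd e f) = icost e + icost f + 1"
| "icost (IMul e f) = icost e + icost f + 1"

primrec rval :: "rexp \<Rightarrow> ram \<Rightarrow> real" where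
  "rval (Const c) s = c"
| "rval (Cell a e) s = mem s (a, ival e s)"
| "rval (Add e f) s = rval e s + rval f s"
| "rval (Sub e f) s = rval e s - rval f s"
| "rval (Mul e f) s = rval e s * rval f s"
| "rval (Div e f) s = rval e s / rval f s"
| "rval (Sqrt e) s = sqrt (rval e s)"

primrec rcost :: "rexp \<Rightarrow> nat" where
  "rcost (Const c) = 1"
| "rcost (Cell a e) = icost e + 1"
| "rcost (Add e f) = rcost e + rcost f + 1"
| "rcost (Sub e f) = rcost e + rcost f + 1"
| "rcost (Mul e f) = rcost e + rcost f + 1"
| "rcost (Div e f) = rcost e + rcost f + 1"
| "rcost (Sqrt e) = rcost e + 1"

primrec rcells :: "rexp \<Rightarrow> ram \<Rightarrow> cell set" where
  "rcells (Const c) s = {}"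
| "rcells (Cell a e) s = {(a, ival e s)}"
| "rcells (Add e f) s = rcells e s \<union> rcells f s"
| "rcells (Sub e f) s = rcells e s \<union> rcells f s"
| "rcells (Mul e f) s = rcells e s \<union> rcells f s"
| "rcells (Div e f) s = rcells e s \<union> rcells f s"
| "rcells (Sqrt e) s = rcells e s"

definition charge :: "nat \<Rightarrow> cell set \<Rightarrow> ram \<Rightarrow> ram" where
  "charge k C s = s\<lparr>steps := steps s + k, cells := cells s \<union> C\<rparr>"

primrec exec :: "com \<Rightarrow> ram \<Rightarrow> ram" where
  "exec Skip s = charge 1 {} s"
| "exec (Assign a e t) s =
     charge (icost e + rcost t + 1) (insert (a, ival e s) (rcells t s))
       (s\<lparr>mem := (mem s)((a, ival e s) := rval t s)\<rparr>)"
| "exec (Read a e) s =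
     charge (icost e + 1) {(a, ival e s)}
       (s\<lparr>mem := (mem s)((a, ival e s) := hd (tape s)), tape := tl (tape s)\<rparr>)"
| "exec (c ;; c') s = exec c' (exec c s)"
| "exec (IfLe t t' c c') s =
     (let s' = charge (rcost t + rcost t' + 1) (rcells t s \<union> rcells t' s) s
      in if rval t s \<le> rval t' s then exec c s' else exec c' s')"
| "exec (For i e c) s =
     fold (\<lambda>k s'. exec c (charge 1 {} (s'\<lparr>idx := (idx s')(i := k)\<rparr>)))
       [0..<ival e s] (charge (icost e + 1) {} s)"

(* The index variable d holds the dimension and the cell r[0] the scale.  The array A holds the
   current matrix in row-major order. *)

abbreviation entryA :: iexp where
  "entryA \<equiv> IAdd (IMul (IVar ''i'') (IVar ''d'')) (IVar ''j'')"

abbreviation for_i :: "com \<Rightarrow> com" where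
  "for_i \<equiv> For ''i'' (IVar ''d'')"

abbreviation for_j :: "com \<Rightarrow> com" where
  "for_j \<equiv> For ''j'' (IVar ''d'')"

abbreviation scalar :: "string \<Rightarrow> rexp" where
  "scalar a \<equiv> Cell a (IConst 0)"

definition init_prog :: com where
  "init_prog =
     for_i (for_j (Assign ''A'' entryA (Const 0))) ;;
     for_i (Assign ''A'' (IAdd (IMul (IVar ''i'') (IVar ''d'')) (IVar ''i''))
              (Div (Const 1) (scalar ''r'')))"

(* With y = A x and s = |y|, the update is A - c y w, where w = y^T A and
   c = (1 - 1/s) / s^2. *)
definition update_prog :: com where
  "update_prog =
     for_i (Read ''x'' (IVar ''i'')) ;;
     for_i (Assign ''y'' (IVar ''i'') (Const 0) ;;
            for_j (Assign ''y'' (IVar ''i'')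
                     (Add (Cell ''y'' (IVar ''i''))
                          (Mul (Cell ''A'' entryA) (Cell ''x'' (IVar ''j'')))))) ;;
     Assign ''s'' (IConst 0) (Const 0) ;;
     for_i (Assign ''s'' (IConst 0)
              (Add (scalar ''s'')
                   (Mul (Cell ''y'' (IVar ''i'')) (Cell ''y'' (IVar ''i''))))) ;;
     Assign ''s'' (IConst 0) (Sqrt (scalar ''s'')) ;;
     IfLe (scalar ''s'') (Const 1)
       Skip
       (for_j (Assign ''w'' (IVar ''j'') (Const 0) ;;
               for_i (Assign ''w'' (IVar ''j'')
                        (Add (Cell ''w'' (IVar ''j''))
                             (Mul (Cell ''y'' (IVar ''i'')) (Cell ''A'' entryA))))) ;;
        Assign ''c'' (IConst 0)
          (Div (Sub (Const 1) (Div (Const 1) (scalar ''s'')))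
               (Mul (scalar ''s'') (scalar ''s''))) ;;
        for_i (for_j (Assign ''A'' entryA
                        (Sub (Cell ''A'' entryA)
                             (Mul (scalar ''c'')
                                  (Mul (Cell ''y'' (IVar ''i'')) (Cell ''w'' (IVar ''j''))))))))"

definition start :: "nat \<Rightarrow> real \<Rightarrow> ram" where
  "start d r =
     \<lparr>idx = (\<lambda>_. 0)(''d'' := d), mem = (\<lambda>_. 0)((''r'', 0) := r), tape = [],
      steps = 0, cells = {(''r'', 0)}\<rparr>"

(* One pass over the stream: the tape only ever holds the point currently being read. *)
definition run_stream :: "nat \<Rightarrow> real \<Rightarrow> (nat \<Rightarrow> real vec) \<Rightarrow> nat \<Rightarrow> ram" where
  "run_stream d r x n =
     fold (\<lambda>t s. exec update_prog (s\<lparr>tape := list_of_vec (x t)\<rparr>)) [1..<Suc n]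
       (exec init_prog (start d r))"

definition stored_matrix :: "nat \<Rightarrow> ram \<Rightarrow> real mat" where
  "stored_matrix d s = mat d d (\<lambda>(i, j). mem s (''A'', i * d + j))"

end

theory Submission
  imports Defs
begin

text \<open>
  Write $\|\cdot\|_F$ for the Frobenius norm. AM-GM for the singular values gives
  $\ln (\det C)^2 \le \|C\|_F^2 - d$, with equality only for orthogonal $C$.

  Optimality of the update: let $\{x : \|Bx\| \le 1\}$ contain the ellipsoid of $A$ and the new point,
  and let $A'$ be the updated matrix. Then $C = B A'^{-1}$ satisfies $\|C\|_F^2 \le d$, so
  $|\det B| \le |\det A'|$, with equality only if both matrices define the same ellipsoid.

  Approximation: for $E^* = \{x : \|Bx\| \le 1\}$ and $D_t = B A_t^{-1}$, an update with
  $s = \|A_{t-1} x_t\| > 1$ raises $\|D_t\|_F^2$ by at most $1 - 1/s^2$ and multiplies $(\det D_t)^2$ by $s^2$,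
  so $\|D_t\|_F^2 - \ln (\det D_t)^2$ never increases. It starts at $O(d (\ln (R/r) + 1))$, and
  $\ln (\det D)^2 \le \|D\|_F^2 / 2$, hence $\|D_n\|_F^2 = O(d (\ln (R/r) + 1))$.
\<close>

text \<open>The singular values of the overview are never constructed. An orthogonal Q with Q A
  lower triangular takes their place: the squared diagonal multiplies to the squared determinant and
  sums to at most the squared Frobenius norm, so AM-GM reduces to ln t <= t - 1 entry by entry. The
  same factor gives the volume, because a triangular substitution can be integrated one coordinate
  at a time.

  The equality case matters because the algorithm is given as a relation, each ellipsoid being some
  volume minimizer. Uniqueness of the minimizer forces every run to agree with the matrix recursion.
  It is uniqueness of the ellipsoid only, as its matrix is determined up to an orthogonal factor.

  The Frobenius norm suits the potential because it bounds the operator norm: for D = B A_n^{-1},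
  every v in the final ellipsoid satisfies |B v| <= ||D||_F |A_n v| <= ||D||_F, so a bound on
  ||D||_F is a dilation factor. A potential that never increases keeps this factor independent of
  the number of points.\<close>

no_notation Finite_Cartesian_Product.vec_nth (infixl \<open>$\<close> 90)

section \<open>Euclidean norm, Frobenius norm and orthogonal matrices\<close>

text \<open>This is the squared norm, the sum of the squared singular values; it is the square that
  changes additively under a stretch.\<close>

definition frob :: "nat \<Rightarrow> real mat \<Rightarrow> real" where
  "frob d A = (\<Sum>i<d. \<Sum>j<d. (A $$ (i, j))\<^sup>2)"

text \<open>For a unit vector \<open>e\<close> this scales the direction \<open>e\<close> by 1 + k
  and fixes its orthogonal complement. An update multiplies by the stretch with factor 1/s and the
  one with factor s undoes it, hence the arguments \<open>1 / s - 1\<close> and \<open>s - 1\<close>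
  below.\<close>

definition stretch :: "nat \<Rightarrow> real vec \<Rightarrow> real \<Rightarrow> real mat" where
  "stretch d e k = mat d d (\<lambda>(i, j). (if i = j then 1 else 0) + k * e $ i * e $ j)"

lemma scalar_prod_eq_sum:
  assumes "w \<in> carrier_vec d"
  shows "v \<bullet> w = (\<Sum>i<d. v $ i * w $ i)"
  using assms by (simp add: scalar_prod_def lessThan_atLeast0)

lemma mult_mat_vec_index:
  assumes "A \<in> carrier_mat d d" "v \<in> carrier_vec d" "i < d"
  shows "(A *\<^sub>v v) $ i = (\<Sum>j<d. A $$ (i, j) * v $ j)"
  using assms by (auto simp: scalar_prod_eq_sum[of v d] intro!: sum.cong)

lemma mult_mat_index:
  assumes "A \<in> carrier_mat d d" "B \<in> carrier_mat d d" "i < d" "j < d"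
  shows "(A * B) $$ (i, j) = (\<Sum>k<d. A $$ (i, k) * B $$ (k, j))"
  using assms by (auto simp: scalar_prod_eq_sum[of "col B j" d] intro!: sum.cong)

lemma scalar_prod_self_ge_0: "(v :: real vec) \<bullet> v \<ge> 0"
  by (auto simp: scalar_prod_def intro: sum_nonneg)

lemma enorm_ge_0: "enorm v \<ge> 0"
  by (simp add: enorm_def scalar_prod_self_ge_0)

lemma enorm_power2: "(enorm v)\<^sup>2 = v \<bullet> v"
  by (simp add: enorm_def scalar_prod_self_ge_0)

lemma enorm_power2_sum:
  "v \<in> carrier_vec d \<Longrightarrow> (enorm v)\<^sup>2 = (\<Sum>i<d. (v $ i)\<^sup>2)"
  unfolding enorm_power2 using scalar_prod_eq_sum[of v d v] by (simp add: power2_eq_square)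

lemma enorm_smult: "enorm (c \<cdot>\<^sub>v v) = \<bar>c\<bar> * enorm v"
proof -
  have "(c \<cdot>\<^sub>v v) \<bullet> (c \<cdot>\<^sub>v v) = c\<^sup>2 * (v \<bullet> v)"
    by (simp add: scalar_prod_def sum_distrib_left power2_eq_square mult.assoc mult.left_commute)
  then show ?thesis by (simp add: enorm_def real_sqrt_mult)
qed

lemma enorm_eq_0_iff: "v \<in> carrier_vec d \<Longrightarrow> enorm v = 0 \<longleftrightarrow> v = 0\<^sub>v d"
  by (subst power2_eq_iff_nonneg[OF enorm_ge_0 order_refl, symmetric])
     (auto simp: enorm_power2_sum sum_nonneg_eq_0_iff)

lemma abs_index_le_enorm:
  assumes "v \<in> carrier_vec d" "i < d"
  shows "\<bar>v $ i\<bar> \<le> enorm v"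
proof -
  have "(v $ i)\<^sup>2 \<le> (enorm v)\<^sup>2"
    unfolding enorm_power2_sum[OF assms(1)] using assms(2)
    by (intro member_le_sum) auto
  then show ?thesis using enorm_ge_0 abs_le_square_iff[of "v $ i" "enorm v"] by simp
qed

lemma frob_ge_0: "frob d A \<ge> 0"
  by (auto simp: frob_def intro!: sum_nonneg)

lemma frob_eq_sum_cols:
  assumes "A \<in> carrier_mat d d"
  shows "frob d A = (\<Sum>j<d. (enorm (col A j))\<^sup>2)"
  unfolding frob_def
  by (subst sum.swap, intro sum.cong refl, subst enorm_power2_sum[of _ d])
     (use assms in \<open>auto intro!: sum.cong\<close>)

text \<open>Cauchy-Schwarz in every row: the Frobenius norm dominates the operator norm. This turns
  the final bound on the potential into a containment of ellipsoids.\<close>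

lemma enorm_mult_mat_vec_le:
  assumes A: "A \<in> carrier_mat d d" and v: "v \<in> carrier_vec d"
  shows "(enorm (A *\<^sub>v v))\<^sup>2 \<le> frob d A * (enorm v)\<^sup>2"
proof -
  have "(enorm (A *\<^sub>v v))\<^sup>2 = (\<Sum>i<d. (\<Sum>j<d. A $$ (i, j) * v $ j)\<^sup>2)"
    using A v by (subst enorm_power2_sum[of _ d]) (auto simp: mult_mat_vec_index simp del: index_mult_mat_vec intro!: sum.cong)
  also have "\<dots> \<le> (\<Sum>i<d. (\<Sum>j<d. (A $$ (i, j))\<^sup>2) * (\<Sum>j<d. (v $ j)\<^sup>2))"
    by (intro sum_mono Cauchy_Schwarz_ineq_sum)
  also have "\<dots> = frob d A * (enorm v)\<^sup>2"
    by (simp add: enorm_power2_sum[OF v] frob_def sum_distrib_right)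
  finally show ?thesis .
qed

lemma stretch_carrier [simp, intro]: "stretch d e k \<in> carrier_mat d d"
  by (simp add: stretch_def)

lemma stretch_mult_vec:
  assumes e: "e \<in> carrier_vec d" and v: "v \<in> carrier_vec d"
  shows "stretch d e k *\<^sub>v v = v + (k * (e \<bullet> v)) \<cdot>\<^sub>v e"
proof (rule eq_vecI)
  fix i assume "i < dim_vec (v + (k * (e \<bullet> v)) \<cdot>\<^sub>v e)"
  then have i: "i < d" using e by simp
  have "(stretch d e k *\<^sub>v v) $ i = (\<Sum>j<d. ((if i = j then 1 else 0) + k * e $ i * e $ j) * v $ j)"
    unfolding mult_mat_vec_index[OF stretch_carrier v i] using i by (simp add: stretch_def)
  also have "\<dots> = (\<Sum>j<d. (if i = j then v $ j else 0) + k * e $ i * (e $ j * v $ j))"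
    by (intro sum.cong) (auto simp: algebra_simps)
  also have "\<dots> = v $ i + k * e $ i * (e \<bullet> v)"
    using i by (simp add: sum.distrib scalar_prod_eq_sum[OF v] sum_distrib_left)
  finally show "(stretch d e k *\<^sub>v v) $ i = (v + (k * (e \<bullet> v)) \<cdot>\<^sub>v e) $ i"
    using e v i by (simp add: algebra_simps)
qed (use e v in \<open>simp add: stretch_def\<close>)

text \<open>Scaling factors multiply: (1 + k)(1 + l) = 1 + (k + l + k l).\<close>

lemma stretch_mult_stretch:
  assumes e: "e \<in> carrier_vec d" "e \<bullet> e = 1"
  shows "stretch d e k * stretch d e l = stretch d e (k + l + k * l)"
proof (rule eq_matI)
  fix i j assume "i < dim_row (stretch d e (k + l + k * l))" "j < dim_col (stretch d e (k + l + k * l))"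
  then have ij: "i < d" "j < d" by (auto simp: stretch_def)
  have "(stretch d e k * stretch d e l) $$ (i, j) =
      (\<Sum>m<d. ((if i = m then 1 else 0) + k * e $ i * e $ m) * ((if m = j then 1 else 0) + l * e $ m * e $ j))"
    unfolding mult_mat_index[OF stretch_carrier stretch_carrier ij] using ij by (simp add: stretch_def)
  also have "\<dots> = (\<Sum>m<d. (if i = m then (if m = j then 1 else 0) + l * e $ m * e $ j else 0)
        + (if m = j then k * e $ i * e $ m else 0) + (k * l * e $ i * e $ j) * (e $ m * e $ m))"
    by (intro sum.cong) (auto simp: algebra_simps)
  also have "\<dots> = (if i = j then 1 else 0) + l * e $ i * e $ j + k * e $ i * e $ j + (k * l * e $ i * e $ j) * (e \<bullet> e)"
    using ij by (simp add: sum.distrib scalar_prod_eq_sum[OF e(1)] flip: sum_distrib_left)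
  also have "\<dots> = stretch d e (k + l + k * l) $$ (i, j)"
    using ij e(2) by (simp add: stretch_def algebra_simps)
  finally show "(stretch d e k * stretch d e l) $$ (i, j) = stretch d e (k + l + k * l) $$ (i, j)" .
qed (simp_all add: stretch_def)

lemma stretch_0: "stretch d e 0 = 1\<^sub>m d"
  by (rule eq_matI) (auto simp: stretch_def)

text \<open>Pythagoras in each row of \<open>D\<close>: the component along \<open>e\<close> is
  scaled by 1 + k and the rest is kept, so its square grows by the factor (1 + k)^2 - 1 = 2 k + k^2.
  These components are the entries of D e.\<close>

lemma frob_mult_stretch:
  assumes D: "D \<in> carrier_mat d d" and e: "e \<in> carrier_vec d" "e \<bullet> e = 1"
  shows "frob d (D * stretch d e k) = frob d D + (2 * k + k\<^sup>2) * (enorm (D *\<^sub>v e))\<^sup>2"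
proof -
  define w where "w i = (\<Sum>j<d. D $$ (i, j) * e $ j)" for i
  have "(D * stretch d e k) $$ (i, j) = D $$ (i, j) + k * w i * e $ j" if ij: "i < d" "j < d" for i j
  proof -
    have "(D * stretch d e k) $$ (i, j) = (\<Sum>m<d. D $$ (i, m) * ((if m = j then 1 else 0) + k * e $ m * e $ j))"
      unfolding mult_mat_index[OF D stretch_carrier ij] using ij by (simp add: stretch_def)
    also have "\<dots> = (\<Sum>m<d. (if m = j then D $$ (i, m) else 0) + (k * e $ j) * (D $$ (i, m) * e $ m))"
      by (intro sum.cong) (auto simp: algebra_simps)
    also have "\<dots> = D $$ (i, j) + k * w i * e $ j"
      using ij by (simp add: sum.distrib w_def flip: sum_distrib_left)
    finally show ?thesis .
  qed
  then have "frob d (D * stretch d e k) = (\<Sum>i<d. \<Sum>j<d. (D $$ (i, j) + k * w i * e $ j)\<^sup>2)"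
    unfolding frob_def by (intro sum.cong) auto
  also have "\<dots> = (\<Sum>i<d. (\<Sum>j<d. (D $$ (i, j))\<^sup>2) + (2 * k + k\<^sup>2) * (w i)\<^sup>2)"
  proof (intro sum.cong refl)
    fix i
    have "(\<Sum>j<d. (D $$ (i, j) + k * w i * e $ j)\<^sup>2) =
      (\<Sum>j<d. (D $$ (i, j))\<^sup>2 + (2 * k * w i) * (D $$ (i, j) * e $ j) + (k * w i)\<^sup>2 * (e $ j * e $ j))"
      by (intro sum.cong) (auto simp: power2_eq_square algebra_simps)
    also have "\<dots> = (\<Sum>j<d. (D $$ (i, j))\<^sup>2) + (2 * k * w i) * w i + (k * w i)\<^sup>2 * (e \<bullet> e)"
      by (simp add: sum.distrib scalar_prod_eq_sum[OF e(1)] w_def flip: sum_distrib_left)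
    finally show "(\<Sum>j<d. (D $$ (i, j) + k * w i * e $ j)\<^sup>2) =
        (\<Sum>j<d. (D $$ (i, j))\<^sup>2) + (2 * k + k\<^sup>2) * (w i)\<^sup>2"
      using e(2) by (simp add: power2_eq_square algebra_simps)
  qed
  also have "\<dots> = frob d D + (2 * k + k\<^sup>2) * (\<Sum>i<d. (w i)\<^sup>2)"
    by (simp add: sum.distrib frob_def sum_distrib_left)
  also have "(\<Sum>i<d. (w i)\<^sup>2) = (enorm (D *\<^sub>v e))\<^sup>2"
    using D e by (subst enorm_power2_sum[of _ d])
      (auto simp: mult_mat_vec_index w_def simp del: index_mult_mat_vec intro!: sum.cong)
  finally show ?thesis .
qed

lemma frob_one: "frob d (1\<^sub>m d) = d"
proof -
  have "frob d (1\<^sub>m d) = (\<Sum>i<d. \<Sum>j<d. if i = j then 1 else 0)"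
    unfolding frob_def by (intro sum.cong) auto
  then show ?thesis by simp
qed

lemma frob_stretch:
  assumes e: "e \<in> carrier_vec d" "e \<bullet> e = 1"
  shows "frob d (stretch d e k) = d + (2 * k + k\<^sup>2)"
  using frob_mult_stretch[of "1\<^sub>m d" d e k] e left_mult_one_mat[OF stretch_carrier, of d e k]
  by (simp add: frob_one enorm_power2)

section \<open>Inverses, orthogonal triangularization and the determinant inequality\<close>

lemma inverse_matE:
  fixes A :: "real mat"
  assumes A: "A \<in> carrier_mat d d" and "det A \<noteq> 0"
  obtains B where "B \<in> carrier_mat d d" "B * A = 1\<^sub>m d" "A * B = 1\<^sub>m d"
proof -
  show ?thesis
    using det_non_zero_imp_unit[OF assms, of "()"] that by (auto simp: Units_def ring_mat_def)
qed

text \<open>Dimension d leaves room for a direction orthogonal to d - 1 given vectors: a zero in row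
  \<open>m\<close> makes the matrix of the \<open>w i\<close> singular, and a normalized kernel
  vector serves.\<close>

lemma exists_unit_vec_orthogonal:
  fixes w :: "nat \<Rightarrow> real vec"
  assumes m: "m < d" and w: "\<And>i. i < d \<Longrightarrow> w i \<in> carrier_vec d"
  obtains q where "q \<in> carrier_vec d" "q \<bullet> q = 1" "\<And>i. i < d \<Longrightarrow> i \<noteq> m \<Longrightarrow> w i \<bullet> q = 0"
proof -
  define M where "M = mat\<^sub>r d d (\<lambda>i. if i = m then 0\<^sub>v d else w i)"
  have M: "M \<in> carrier_mat d d" by (simp add: M_def)
  have "det M = 0" unfolding M_def using det_row_0[OF m, of w] w by auto
  then obtain v where v: "v \<in> carrier_vec d" "v \<noteq> 0\<^sub>v d" "M *\<^sub>v v = 0\<^sub>v d"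
    using det_0_iff_vec_prod_zero_field[OF M] by blast
  have ev: "enorm v > 0" using enorm_eq_0_iff[OF v(1)] v(2) enorm_ge_0[of v] by linarith
  define q where "q = (1 / enorm v) \<cdot>\<^sub>v v"
  show ?thesis
  proof (rule that[of q])
    show "q \<in> carrier_vec d" using v by (simp add: q_def)
    show "q \<bullet> q = 1" using ev by (simp add: enorm_power2[symmetric] q_def enorm_smult)
    fix i assume i: "i < d" "i \<noteq> m"
    have "row M i = w i" using i w[of i] by (intro eq_vecI) (auto simp: M_def)
    moreover have "(M *\<^sub>v v) $ i = 0" using v(3) i(1) by simp
    ultimately have "w i \<bullet> v = 0" using M i(1) by simp
    then show "w i \<bullet> q = 0" using v(1) w[OF i(1)] by (simp add: q_def)
  qed
qed

lemma orthogonal_matD: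
  fixes Q :: "real mat"
  assumes Q: "Q \<in> carrier_mat d d" "Q * Q\<^sup>T = 1\<^sub>m d"
  shows "v \<in> carrier_vec d \<Longrightarrow> enorm (Q *\<^sub>v v) = enorm v" "(det Q)\<^sup>2 = 1"
proof -
  have QT: "Q\<^sup>T * Q = 1\<^sub>m d" using mat_mult_left_right_inverse[OF Q(1) _ Q(2)] Q(1) by simp
  have "det (Q * Q\<^sup>T) = 1" using Q by simp
  then show "(det Q)\<^sup>2 = 1" using det_mult[OF Q(1), of "Q\<^sup>T"] Q(1) det_transpose[OF Q(1)]
    by (simp add: power2_eq_square)
  assume v: "v \<in> carrier_vec d"
  have "(Q *\<^sub>v v) \<bullet> (Q *\<^sub>v v) = (Q\<^sup>T *\<^sub>v (Q *\<^sub>v v)) \<bullet> v"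
    using transpose_vec_mult_scalar[of "Q" d d v "Q *\<^sub>v v"] Q(1) v
    by (simp add: comm_scalar_prod[of _ d])
  also have "Q\<^sup>T *\<^sub>v (Q *\<^sub>v v) = v" using Q QT v by (simp flip: assoc_mult_mat_vec[of _ d d _ d])
  finally show "enorm (Q *\<^sub>v v) = enorm v" by (simp add: enorm_def)
qed

lemma exists_orthogonal_lower_triangular:
  fixes A :: "real mat"
  assumes A: "A \<in> carrier_mat d d"
  obtains Q where "Q \<in> carrier_mat d d" "Q * Q\<^sup>T = 1\<^sub>m d"
    "\<And>i j. i < j \<Longrightarrow> j < d \<Longrightarrow> (Q * A) $$ (i, j) = 0"
proof -
  \<comment> \<open>the rows are chosen one by one: the $i$-th has to avoid only $d - 1$ vectors, the earlier rows and the columns $j > i$\<close>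
  have "\<exists>q. \<forall>i<m. q i \<in> carrier_vec d \<and> q i \<bullet> q i = 1 \<and> (\<forall>k<i. q k \<bullet> q i = 0) \<and>
        (\<forall>j. i < j \<and> j < d \<longrightarrow> col A j \<bullet> q i = 0)" if "m \<le> d" for m
    using that
  proof (induction m)
    case (Suc m)
    then obtain q where q: "\<forall>i<m. q i \<in> carrier_vec d \<and> q i \<bullet> q i = 1 \<and> (\<forall>k<i. q k \<bullet> q i = 0) \<and>
        (\<forall>j. i < j \<and> j < d \<longrightarrow> col A j \<bullet> q i = 0)" by auto
    obtain p where p: "p \<in> carrier_vec d" "p \<bullet> p = 1"
      "\<And>i. i < d \<Longrightarrow> i \<noteq> m \<Longrightarrow> (if i < m then q i else col A i) \<bullet> p = 0"
    proof (rule exists_unit_vec_orthogonal[of m d "\<lambda>i. if i < m then q i else col A i"])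
      show "(if i < m then q i else col A i) \<in> carrier_vec d" if "i < d" for i
        using q A that by auto
    qed (use Suc.prems in auto)
    have "q k \<bullet> p = 0" if "k < m" for k using p(3)[of k] that Suc.prems by simp
    moreover have "col A j \<bullet> p = 0" if "m < j" "j < d" for j using p(3)[of j] that by simp
    ultimately show ?case using q p(1,2)
      by (intro exI[of _ "q(m := p)"]) (auto simp: less_Suc_eq)
  qed simp
  from this[OF order_refl] obtain q where q': "\<forall>i<d. q i \<in> carrier_vec d \<and> q i \<bullet> q i = 1 \<and>
      (\<forall>k<i. q k \<bullet> q i = 0) \<and> (\<forall>j. i < j \<and> j < d \<longrightarrow> col A j \<bullet> q i = 0)" by (elim exE)
  have q: "q i \<in> carrier_vec d" "q i \<bullet> q i = 1" "k < i \<Longrightarrow> q k \<bullet> q i = 0"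
     "i < j \<Longrightarrow> j < d \<Longrightarrow> col A j \<bullet> q i = 0" if "i < d" for i j k
    using q' that by auto
  define Q where "Q = mat_of_rows d (map q [0..<d])"
  have Q: "Q \<in> carrier_mat d d" using mat_of_rows_carrier(1)[of d "map q [0..<d]"] by (simp add: Q_def)
  have row: "row Q i = q i" if "i < d" for i using that q(1) by (simp add: Q_def)
  show ?thesis
  proof (rule that[OF Q])
    have sym: "q i \<bullet> q j = 0" if "i < d" "j < d" "i \<noteq> j" for i j
      using q(3)[of i j] q(3)[of j i] that comm_scalar_prod[OF q(1) q(1), of i j]
      by (cases i j rule: linorder_cases) auto
    show "Q * Q\<^sup>T = 1\<^sub>m d"
      using Q row q(2) sym by (intro eq_matI) auto
    fix i j :: nat assume "i < j" "j < d"
    then show "(Q * A) $$ (i, j) = 0"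
      using Q A row q(1,4)[of i] comm_scalar_prod[of "q i" d "col A j"] by simp
  qed
qed

lemma frob_orthogonal_mult:
  assumes Q: "Q \<in> carrier_mat d d" "Q * Q\<^sup>T = 1\<^sub>m d" and A: "A \<in> carrier_mat d d"
  shows "frob d (Q * A) = frob d A"
proof -
  have "enorm (col (Q * A) j) = enorm (col A j)" if "j < d" for j
    unfolding col_mult2[OF Q(1) A that] using orthogonal_matD(1)[OF Q, of "col A j"] A that by auto
  then show ?thesis using Q A by (simp add: frob_eq_sum_cols)
qed

text \<open>AM-GM for the squared singular values of $C$, carried out on the diagonal of a triangular factor instead.\<close>

lemma ln_det_le_frob:
  assumes C: "C \<in> carrier_mat d d" and det: "det C \<noteq> 0"
  shows "ln ((det C)\<^sup>2) \<le> frob d C - d" (is ?le)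
    and "ln ((det C)\<^sup>2) = frob d C - d \<Longrightarrow> v \<in> carrier_vec d \<Longrightarrow> enorm (C *\<^sub>v v) = enorm v"
proof -
  obtain Q where Q: "Q \<in> carrier_mat d d" "Q * Q\<^sup>T = 1\<^sub>m d"
    and tri: "\<And>i j. i < j \<Longrightarrow> j < d \<Longrightarrow> (Q * C) $$ (i, j) = 0"
    using exists_orthogonal_lower_triangular[OF C] by blast
  define L where "L = Q * C"
  have L: "L \<in> carrier_mat d d" using Q C by (simp add: L_def)
  define l where "l i = (L $$ (i, i))\<^sup>2" for i
  define off where "off i = (\<Sum>j\<in>{..<d} - {i}. (L $$ (i, j))\<^sup>2)" for i
  have "det L = (\<Prod>i<d. L $$ (i, i))"
    using det_lower_triangular[OF _ L] tri L
    by (simp add: L_def[symmetric] prod_list_diag_prod lessThan_atLeast0)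
  then have det2: "(det C)\<^sup>2 = (\<Prod>i<d. l i)"
    using det_mult[OF Q(1) C] orthogonal_matD(2)[OF Q]
    by (simp add: L_def[symmetric] l_def power_mult_distrib flip: prod_power_distrib)
  then have nz: "l i > 0" if "i < d" for i
  proof -
    have "(\<Prod>i<d. l i) \<noteq> 0" unfolding det2[symmetric] using det by simp
    then show ?thesis using that by (auto simp: l_def)
  qed
  have lnd: "ln ((det C)\<^sup>2) = (\<Sum>i<d. ln (l i))"
    unfolding det2 by (intro ln_prod) (auto dest: nz)
  have fr: "frob d C = (\<Sum>i<d. l i + off i)"
  proof -
    have "frob d C = frob d L" using frob_orthogonal_mult[OF Q C] by (simp add: L_def)
    also have "\<dots> = (\<Sum>i<d. l i + off i)"
      unfolding frob_def l_def off_def by (intro sum.cong refl sum.remove) auto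
    finally show ?thesis .
  qed
  \<comment> \<open>All parts of the sum are nonnegative, the first by ln t <= t - 1, so the
    inequality and its equality case can both be read off this identity.\<close>
  have gap: "frob d C - d - ln ((det C)\<^sup>2) = (\<Sum>i<d. (l i - 1 - ln (l i)) + off i)"
    by (simp add: lnd fr sum.distrib sum_subtractf)
  have off0: "off i \<ge> 0" for i by (auto simp: off_def intro: sum_nonneg)
  have term0: "(l i - 1 - ln (l i)) + off i \<ge> 0" if "i < d" for i
    using ln_le_minus_one[OF nz[OF that]] off0[of i] by linarith
  show ?le using gap sum_nonneg[of "{..<d}" "\<lambda>i. (l i - 1 - ln (l i)) + off i"] term0 by simp
  assume eq: "ln ((det C)\<^sup>2) = frob d C - d" and v: "v \<in> carrier_vec d"
  then have "(\<Sum>i<d. (l i - 1 - ln (l i)) + off i) = 0" using gap by simp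
  then have "(l i - 1 - ln (l i)) + off i = 0" if "i < d" for i
    using term0 that by (subst (asm) sum_nonneg_eq_0_iff) auto
  then have "l i - 1 - ln (l i) = 0" "off i = 0" if "i < d" for i
    using ln_le_minus_one[OF nz[OF that]] off0[of i] that by (fastforce simp: add_nonneg_eq_0_iff)+
  then have "l i = 1" "off i = 0" if "i < d" for i
    using that ln_eq_minus_one[OF nz[OF that]] by simp_all
  \<comment> \<open>\<open>L\<close> is now diagonal with entries 1 or -1, so it preserves norms,
    and \<open>C\<close> differs from it by the orthogonal factor \<open>Q\<close>.\<close>
  then have diag: "(L $$ (i, i))\<^sup>2 = 1" "\<And>j. j < d \<Longrightarrow> j \<noteq> i \<Longrightarrow> L $$ (i, j) = 0" if "i < d" for i
    using that by (auto simp: l_def off_def sum_nonneg_eq_0_iff)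
  have "(L *\<^sub>v v) $ i = L $$ (i, i) * v $ i" if "i < d" for i
  proof -
    have "(L *\<^sub>v v) $ i = (\<Sum>j<d. if j = i then L $$ (i, i) * v $ i else 0)"
      unfolding mult_mat_vec_index[OF L v that] using diag(2)[OF that] by (intro sum.cong) auto
    then show ?thesis using that by simp
  qed
  then have "(enorm (L *\<^sub>v v))\<^sup>2 = (enorm v)\<^sup>2"
    using L v diag(1) by (subst (1 2) enorm_power2_sum[of _ d])
      (auto simp: power_mult_distrib simp del: index_mult_mat_vec)
  then have "enorm (L *\<^sub>v v) = enorm v" using enorm_ge_0 by simp
  then show "enorm (C *\<^sub>v v) = enorm v"
    using orthogonal_matD(1)[OF Q, of "C *\<^sub>v v"] Q C v by (simp add: L_def)
qed

section \<open>Volume of ellipsoids\<close>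

abbreviation lborel_pow :: "nat \<Rightarrow> (nat \<Rightarrow> real) measure" where
  "lborel_pow d \<equiv> \<Pi>\<^sub>M i\<in>{..<d}. lborel"

interpretation lborel_prod: product_sigma_finite "\<lambda>_::nat. lborel :: real measure" ..

text \<open>The restricted abstraction keeps the image in the space of the product measure, whose
  elements are extensional functions. Coordinate i sees only coordinates up to i, which lets the
  substitution be made one variable at a time.\<close>

definition lower_tri_map :: "(nat \<Rightarrow> nat \<Rightarrow> real) \<Rightarrow> nat \<Rightarrow> (nat \<Rightarrow> real) \<Rightarrow> nat \<Rightarrow> real" where
  "lower_tri_map L d v = (\<lambda>i\<in>{..<d}. \<Sum>j\<le>i. L i j * v j)"

lemma measurable_lower_tri_map [measurable]:
  "lower_tri_map L d \<in> measurable (lborel_pow d) (lborel_pow d)"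
  unfolding lower_tri_map_def
proof (rule measurable_restrict)
  fix i assume "i \<in> {..<d}"
  then have "(\<lambda>v. v j) \<in> borel_measurable (lborel_pow d)" if "j \<le> i" for j
    using that measurable_component_singleton[of j "{..<d}" "\<lambda>_. lborel :: real measure"] by simp
  then have "(\<lambda>v. \<Sum>j\<le>i. L i j * v j) \<in> borel_measurable (lborel_pow d)"
    by (intro borel_measurable_sum borel_measurable_times) auto
  then show "(\<lambda>v. \<Sum>j\<le>i. L i j * v j) \<in> measurable (lborel_pow d) lborel"
    by simp
qed

text \<open>Fubini by induction on \<open>d\<close>: with the earlier coordinates fixed, the new
  last coordinate is an affine function of the old one with slope \<open>L d d\<close>, and
  one-dimensional substitution contributes the factor |L d d|.\<close>

lemma nn_integral_lower_tri_map:
  assumes "\<And>i. i < d \<Longrightarrow> L i i \<noteq> 0" and "f \<in> borel_measurable (lborel_pow d)"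
  shows "(\<integral>\<^sup>+v. f v \<partial>lborel_pow d) =
           ennreal (\<Prod>i<d. \<bar>L i i\<bar>) * (\<integral>\<^sup>+v. f (lower_tri_map L d v) \<partial>lborel_pow d)"
  using assms
proof (induction d arbitrary: f)
  case 0
  have "(\<integral>\<^sup>+v. f v \<partial>lborel_pow 0) = (\<integral>\<^sup>+v. f (lower_tri_map L 0 v) \<partial>lborel_pow 0)"
    by (intro nn_integral_cong arg_cong[where f = f]) (auto simp: space_PiM lower_tri_map_def fun_eq_iff)
  then show ?case by simp
next
  case (Suc d)
  have f [measurable]: "f \<in> borel_measurable (PiM (insert d {..<d}) (\<lambda>_. lborel))"
    using Suc.prems(2) by (simp add: lessThan_Suc)
  have add_dim: "(\<lambda>(z, w). z(d := w)) \<in> measurable (lborel_pow d \<Otimes>\<^sub>M lborel) (PiM (insert d {..<d}) (\<lambda>_. lborel :: real measure))"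
    by (rule measurable_add_dim)
  define G where "G z = (\<integral>\<^sup>+w. f (z(d := w)) \<partial>lborel)" for z
  have G: "G \<in> borel_measurable (lborel_pow d)"
    unfolding G_def using measurable_compose[OF add_dim f]
    by (intro lborel.borel_measurable_nn_integral) (simp add: case_prod_beta')
  \<comment> \<open>\<open>c v\<close> is the shift of the last coordinate caused by the earlier
    ones; Lebesgue measure does not see it.\<close>
  define c where "c v = (\<Sum>j<d. L d j * v j)" for v
  have TG: "(\<integral>\<^sup>+y. f (lower_tri_map L (Suc d) (v(d := y))) \<partial>lborel) * ennreal \<bar>L d d\<bar> = G (lower_tri_map L d v)"
    if v: "v \<in> space (lborel_pow d)" for v
  proof -
    let ?z = "lower_tri_map L d v"
    have z: "?z \<in> space (lborel_pow d)" using measurable_space[OF measurable_lower_tri_map v] .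
    have *: "lower_tri_map L (Suc d) (v(d := y)) = ?z(d := c v + L d d * y)" for y
    proof
      fix i
      have "(\<Sum>j\<le>d. L d j * (v(d := y)) j) = c v + L d d * y"
        by (simp add: c_def lessThan_Suc_atMost[symmetric])
      moreover have "(\<Sum>j\<le>i. L i j * (v(d := y)) j) = (\<Sum>j\<le>i. L i j * v j)" if "i < d"
        using that by (intro sum.cong) auto
      ultimately show "lower_tri_map L (Suc d) (v(d := y)) i = (?z(d := c v + L d d * y)) i"
        by (auto simp: lower_tri_map_def restrict_def less_Suc_eq)
    qed
    have "(\<lambda>w. f (?z(d := w))) \<in> borel_measurable borel"
      using measurable_compose[OF measurable_Pair1'[OF z] measurable_compose[OF add_dim f]]
      by simp
    then have "G ?z = ennreal \<bar>L d d\<bar> * (\<integral>\<^sup>+y. f (?z(d := c v + L d d * y)) \<partial>lborel)"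
      unfolding G_def using Suc.prems(1)[of d] by (intro nn_integral_real_affine) auto
    then show ?thesis by (simp add: * mult.commute)
  qed
  have comp: "(\<lambda>v. f (lower_tri_map L (Suc d) v)) \<in> borel_measurable (PiM (insert d {..<d}) (\<lambda>_. lborel))"
    using measurable_compose[OF measurable_lower_tri_map[of L "Suc d"] Suc.prems(2)] by (simp add: lessThan_Suc)
  have "(\<integral>\<^sup>+v. f v \<partial>lborel_pow (Suc d)) = (\<integral>\<^sup>+z. G z \<partial>lborel_pow d)"
    unfolding G_def lessThan_Suc by (rule lborel_prod.product_nn_integral_insert) (use f in auto)
  also have "\<dots> = ennreal (\<Prod>i<d. \<bar>L i i\<bar>) * (\<integral>\<^sup>+v. G (lower_tri_map L d v) \<partial>lborel_pow d)"
    by (rule Suc.IH[OF _ G]) (use Suc.prems in auto)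
  also have "(\<integral>\<^sup>+v. G (lower_tri_map L d v) \<partial>lborel_pow d) =
      (\<integral>\<^sup>+v. (\<integral>\<^sup>+y. f (lower_tri_map L (Suc d) (v(d := y))) \<partial>lborel) * ennreal \<bar>L d d\<bar> \<partial>lborel_pow d)"
    by (intro nn_integral_cong) (simp add: TG)
  also have "\<dots> = (\<integral>\<^sup>+v. (\<integral>\<^sup>+y. f (lower_tri_map L (Suc d) (v(d := y))) \<partial>lborel) \<partial>lborel_pow d) * ennreal \<bar>L d d\<bar>"
    using measurable_compose[OF add_dim comp]
    by (intro nn_integral_multc lborel.borel_measurable_nn_integral) (simp add: case_prod_beta')
  also have "(\<integral>\<^sup>+v. (\<integral>\<^sup>+y. f (lower_tri_map L (Suc d) (v(d := y))) \<partial>lborel) \<partial>lborel_pow d) =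
      (\<integral>\<^sup>+v. f (lower_tri_map L (Suc d) v) \<partial>lborel_pow (Suc d))"
    unfolding lessThan_Suc
    by (rule lborel_prod.product_nn_integral_insert[symmetric]) (use comp in auto)
  finally show ?case by (simp add: ennreal_mult' prod_nonneg mult_ac)
qed

text \<open>The constant is never evaluated: being positive and finite, it cancels in every
  comparison of volumes.\<close>

definition unit_ball_measure :: "nat \<Rightarrow> ennreal" where
  "unit_ball_measure d = emeasure (lborel_pow d) {f \<in> space (lborel_pow d). (\<Sum>i<d. (f i)\<^sup>2) \<le> 1}"

lemma sets_unit_ball [measurable]:
  "{f \<in> space (lborel_pow d). (\<Sum>i<d. (f i)\<^sup>2) \<le> 1} \<in> sets (lborel_pow d)"
  by measurable

text \<open>\<open>A\<close> and the triangular \<open>Q * A\<close> define the same ellipsoid and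
  have the same |det|, and that ellipsoid is the preimage of the unit ball under the triangular map.
  The product form postpones division in \<open>ennreal\<close> until finiteness is
  available.\<close>

lemma volume_mat_ellipsoid:
  assumes A: "A \<in> carrier_mat d d" and det: "det A \<noteq> 0"
  shows "unit_ball_measure d = ennreal \<bar>det A\<bar> * volume d (mat_ellipsoid d A)"
proof -
  obtain Q where Q: "Q \<in> carrier_mat d d" "Q * Q\<^sup>T = 1\<^sub>m d"
    and tri: "\<And>i j. i < j \<Longrightarrow> j < d \<Longrightarrow> (Q * A) $$ (i, j) = 0"
    using exists_orthogonal_lower_triangular[OF A] by blast
  define L where "L i j = (Q * A) $$ (i, j)" for i j
  have QA: "Q * A \<in> carrier_mat d d" using Q A by simp
  have "det (Q * A) = (\<Prod>i<d. L i i)"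
    using det_lower_triangular[OF _ QA] tri QA Q(1)
    by (simp add: L_def prod_list_diag_prod lessThan_atLeast0)
  moreover have "\<bar>det (Q * A)\<bar> = \<bar>det A\<bar>"
    using det_mult[OF Q(1) A] orthogonal_matD(2)[OF Q] by (auto simp: power2_eq_1_iff abs_mult)
  ultimately have dL: "\<bar>det A\<bar> = (\<Prod>i<d. \<bar>L i i\<bar>)" by (simp add: abs_prod)
  have "(\<Prod>i<d. \<bar>L i i\<bar>) \<noteq> 0" unfolding dL[symmetric] using det by simp
  then have nz: "L i i \<noteq> 0" if "i < d" for i using that by auto
  let ?S = "{f \<in> space (lborel_pow d). (\<Sum>i<d. (f i)\<^sup>2) \<le> 1}"
  have "enorm (A *\<^sub>v vec d v) \<le> 1 \<longleftrightarrow> (\<Sum>i<d. (lower_tri_map L d v i)\<^sup>2) \<le> 1" for v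
  proof -
    have "(lower_tri_map L d v i) = ((Q * A) *\<^sub>v vec d v) $ i" if "i < d" for i
      unfolding mult_mat_vec_index[OF QA vec_carrier that] lower_tri_map_def using that tri
      by (auto simp: L_def intro!: sum.mono_neutral_cong_left) (metis not_le_imp_less)
    then have "(\<Sum>i<d. (lower_tri_map L d v i)\<^sup>2) = (enorm ((Q * A) *\<^sub>v vec d v))\<^sup>2"
      using QA by (subst enorm_power2_sum[of _ d]) auto
    also have "enorm ((Q * A) *\<^sub>v vec d v) = enorm (A *\<^sub>v vec d v)"
      using Q A orthogonal_matD(1)[OF Q, of "A *\<^sub>v vec d v"] by simp
    finally show ?thesis using enorm_ge_0 by (simp add: abs_square_le_1)
  qed
  then have pre: "{f \<in> space (lborel_pow d). vec d f \<in> mat_ellipsoid d A} =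
      {v \<in> space (lborel_pow d). lower_tri_map L d v \<in> ?S}"
    using measurable_space[OF measurable_lower_tri_map, of _ d L] by (auto simp: mat_ellipsoid_def)
  have "unit_ball_measure d = (\<integral>\<^sup>+v. indicator ?S v \<partial>lborel_pow d)"
    by (simp add: unit_ball_measure_def)
  also have "\<dots> = ennreal (\<Prod>i<d. \<bar>L i i\<bar>) * (\<integral>\<^sup>+v. indicator ?S (lower_tri_map L d v) \<partial>lborel_pow d)"
    by (rule nn_integral_lower_tri_map) (use nz in auto)
  also have "(\<integral>\<^sup>+v. indicator ?S (lower_tri_map L d v) \<partial>lborel_pow d) =
      (\<integral>\<^sup>+v. indicator {v \<in> space (lborel_pow d). lower_tri_map L d v \<in> ?S} v \<partial>lborel_pow d)"
    by (intro nn_integral_cong) (auto simp: indicator_def)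
  also have "\<dots> = volume d (mat_ellipsoid d A)"
    unfolding volume_def Let_def pre by (rule nn_integral_indicator) measurable
  finally show ?thesis by (simp add: dL)
qed

lemma emeasure_box:
  assumes "a \<ge> 0"
  shows "emeasure (lborel_pow d) (PiE {..<d} (\<lambda>_. {-a..a})) = ennreal (2 * a) ^ d"
  using assms by (subst lborel_prod.emeasure_PiM) auto

lemma unit_ball_measure_finite: "unit_ball_measure d < \<infinity>"
proof -
  have "{f \<in> space (lborel_pow d). (\<Sum>i<d. (f i)\<^sup>2) \<le> 1} \<subseteq> PiE {..<d} (\<lambda>_. {-1..1::real})"
  proof (intro subsetI PiE_I)
    fix f :: "nat \<Rightarrow> real" and i
    assume "f \<in> {f \<in> space (lborel_pow d). (\<Sum>i<d. (f i)\<^sup>2) \<le> 1}" "i \<in> {..<d}"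
    then have "(f i)\<^sup>2 \<le> 1" using member_le_sum[of i "{..<d}" "\<lambda>i. (f i)\<^sup>2"] by simp
    then show "f i \<in> {-1..1}" using abs_square_le_1[of "f i"] by auto
  qed (auto simp: space_PiM PiE_def extensional_def)
  then have "unit_ball_measure d \<le> emeasure (lborel_pow d) (PiE {..<d} (\<lambda>_. {-1..1}))"
    unfolding unit_ball_measure_def by (rule emeasure_mono) auto
  also have "\<dots> < \<infinity>" by (subst emeasure_box) (auto simp: power_less_top_ennreal)
  finally show ?thesis .
qed

lemma unit_ball_measure_pos: "unit_ball_measure d > 0"
proof -
  \<comment> \<open>The cube with half side \<open>a\<close> fits into the ball, as d a^2 <= 1. The
    summand 1 keeps \<open>a\<close> positive in dimension 0.\<close>
  define a where "a = 1 / sqrt (real d + 1)"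
  have a: "a > 0" "real d * a\<^sup>2 \<le> 1" by (auto simp: a_def power_divide)
  have "PiE {..<d} (\<lambda>_. {-a..a}) \<subseteq> {f \<in> space (lborel_pow d). (\<Sum>i<d. (f i)\<^sup>2) \<le> 1}"
  proof safe
    fix f :: "nat \<Rightarrow> real" assume f: "f \<in> PiE {..<d} (\<lambda>_. {-a..a})"
    have "(f i)\<^sup>2 \<le> a\<^sup>2" if "i < d" for i
      using f that a by (intro power2_le_iff_abs_le[THEN iffD2]) (auto simp: PiE_def Pi_def abs_le_iff minus_le_iff)
    then have "(\<Sum>i<d. (f i)\<^sup>2) \<le> (\<Sum>i<d. a\<^sup>2)" by (intro sum_mono) auto
    then show "(\<Sum>i<d. (f i)\<^sup>2) \<le> 1" using a by simp
  qed (auto simp: space_PiM PiE_def extensional_def)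
  then have "emeasure (lborel_pow d) (PiE {..<d} (\<lambda>_. {-a..a})) \<le> unit_ball_measure d"
    unfolding unit_ball_measure_def by (rule emeasure_mono) auto
  moreover have "emeasure (lborel_pow d) (PiE {..<d} (\<lambda>_. {-a..a})) > 0"
    using a by (subst emeasure_box) (auto simp: ennreal_power)
  ultimately show ?thesis by (rule order.strict_trans2[rotated])
qed

text \<open>Both volumes are the same positive real divided by |det|, so minimizing volume becomes
  maximizing a determinant.\<close>

lemma volume_le_iff_det_ge:
  assumes A: "A \<in> carrier_mat d d" "det A \<noteq> 0" and B: "B \<in> carrier_mat d d" "det B \<noteq> 0"
  shows "volume d (mat_ellipsoid d A) \<le> volume d (mat_ellipsoid d B) \<longleftrightarrow> \<bar>det B\<bar> \<le> \<bar>det A\<bar>"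
proof -
  obtain c where c: "unit_ball_measure d = ennreal c" "c > 0"
    using unit_ball_measure_finite[of d] unit_ball_measure_pos[of d]
    by (cases "unit_ball_measure d") auto
  have vol: "volume d (mat_ellipsoid d A) = ennreal (c / \<bar>det A\<bar>)"
    if "A \<in> carrier_mat d d" "det A \<noteq> 0" for A
  proof -
    have "ennreal (c / \<bar>det A\<bar>) = ennreal \<bar>det A\<bar> * volume d (mat_ellipsoid d A) / ennreal \<bar>det A\<bar>"
      unfolding volume_mat_ellipsoid[OF that, symmetric] using c that by (simp add: divide_ennreal)
    also have "\<dots> = volume d (mat_ellipsoid d A)"
      using that by (simp add: mult.commute[of "ennreal _"] mult_divide_eq_ennreal)
    finally show ?thesis ..
  qed
  show ?thesis using c A B by (simp add: vol field_simps)
qed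

section \<open>The update as minimum-volume ellipsoid\<close>

lemma stretch_inverse:
  assumes e: "e \<in> carrier_vec d" "e \<bullet> e = 1" and s: "s \<noteq> 0"
  shows "stretch d e (s - 1) * stretch d e (1 / s - 1) = 1\<^sub>m d"
proof -
  have "s - 1 + (1 / s - 1) + (s - 1) * (1 / s - 1) = 0" using s by (simp add: field_simps)
  then show ?thesis using stretch_mult_stretch[OF e, of "s - 1" "1 / s - 1"] by (simp add: stretch_0)
qed

text \<open>The squared norm changes by the squared component along \<open>e\<close> times (1 + k)^2
  - 1, which is nonpositive for these \<open>k\<close>.\<close>

lemma stretch_contraction:
  assumes e: "e \<in> carrier_vec d" "e \<bullet> e = 1" and v: "v \<in> carrier_vec d" and k: "-1 \<le> k" "k \<le> 0"
  shows "enorm (stretch d e k *\<^sub>v v) \<le> enorm v"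
proof -
  have "(enorm (stretch d e k *\<^sub>v v))\<^sup>2 = v \<bullet> v + (2 * k + k\<^sup>2) * (e \<bullet> v)\<^sup>2"
    unfolding enorm_power2 stretch_mult_vec[OF e(1) v]
    using e v by (simp add: add_scalar_prod_distrib[of _ d] scalar_prod_add_distrib[of _ d]
        comm_scalar_prod[of v d e] power2_eq_square algebra_simps)
  also have "2 * k + k\<^sup>2 = - (- k * (2 + k))" by (simp add: power2_eq_square algebra_simps)
  also have "v \<bullet> v + - (- k * (2 + k)) * (e \<bullet> v)\<^sup>2 \<le> v \<bullet> v"
    using k mult_nonneg_nonneg[of "- k" "2 + k"] by (simp add: mult_nonneg_nonneg mult_nonpos_nonneg)
  finally show ?thesis using power2_le_imp_le enorm_ge_0 by (simp add: enorm_power2[symmetric])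
qed

text \<open>A point that is already covered is the case $s = 1$, with an arbitrary unit vector $e$.\<close>

lemma update_matrixE:
  assumes d: "0 < d" and A: "A \<in> carrier_mat d d" and x: "x \<in> carrier_vec d"
  obtains e s where "e \<in> carrier_vec d" "e \<bullet> e = 1" "1 \<le> s"
    "update_matrix d A x = stretch d e (1 / s - 1) * A"
    "s = 1 \<and> enorm (A *\<^sub>v x) \<le> 1 \<or> A *\<^sub>v x = s \<cdot>\<^sub>v e"
proof (cases "enorm (A *\<^sub>v x) \<le> 1")
  case True
  then show ?thesis
    using A d by (intro that[of "unit_vec d 0" 1]) (auto simp: update_matrix_def stretch_0)
next
  case False
  define s where "s = enorm (A *\<^sub>v x)"
  define e where "e = (1 / s) \<cdot>\<^sub>v (A *\<^sub>v x)"
  have y: "A *\<^sub>v x \<in> carrier_vec d" using A x by simp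
  have s: "s > 1" using False by (simp add: s_def)
  show ?thesis
  proof (rule that[of e s])
    show "e \<in> carrier_vec d" using y by (simp add: e_def)
    show "e \<bullet> e = 1" using s by (simp add: enorm_power2[symmetric] e_def enorm_smult flip: s_def)
    show "1 \<le> s" using s by simp
    show "s = 1 \<and> enorm (A *\<^sub>v x) \<le> 1 \<or> A *\<^sub>v x = s \<cdot>\<^sub>v e"
      using s y by (auto simp: e_def smult_smult_assoc)
    \<comment> \<open>With y = s e, the rank-one term y y^T / s^2 is e e^T.\<close>
    have "1\<^sub>m d - (1 - 1 / s) \<cdot>\<^sub>m mat d d (\<lambda>(i, j). (A *\<^sub>v x) $ i * (A *\<^sub>v x) $ j / s\<^sup>2)
        = stretch d e (1 / s - 1)"
    proof (rule eq_matI)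
      fix i j assume "i < dim_row (stretch d e (1 / s - 1))" "j < dim_col (stretch d e (1 / s - 1))"
      then have ij: "i < d" "j < d" by (auto simp: stretch_def)
      then have "e $ i = (A *\<^sub>v x) $ i / s" "e $ j = (A *\<^sub>v x) $ j / s"
        using y A by (simp_all add: e_def del: index_mult_mat_vec)
      then show "(1\<^sub>m d - (1 - 1 / s) \<cdot>\<^sub>m mat d d (\<lambda>(i, j). (A *\<^sub>v x) $ i * (A *\<^sub>v x) $ j / s\<^sup>2)) $$ (i, j)
          = stretch d e (1 / s - 1) $$ (i, j)"
        using ij s by (simp add: stretch_def diff_divide_distrib left_diff_distrib power2_eq_square del: index_mult_mat_vec)
    qed (auto simp: stretch_def)
    then show "update_matrix d A x = stretch d e (1 / s - 1) * A"
      using False by (simp add: update_matrix_def s_def Let_def)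
  qed
qed

lemma det_stretch_nonzero:
  assumes e: "e \<in> carrier_vec d" "e \<bullet> e = 1" and s: "s \<noteq> 0"
  shows "det (stretch d e (1 / s - 1)) \<noteq> 0"
proof
  assume "det (stretch d e (1 / s - 1)) = 0"
  then have "det (stretch d e (s - 1) * stretch d e (1 / s - 1)) = 0"
    by (simp add: det_mult[of _ d])
  then show False by (simp add: stretch_inverse[OF assms])
qed

lemma update_matrix_carrier:
  "A \<in> carrier_mat d d \<Longrightarrow> update_matrix d A x \<in> carrier_mat d d"
  by (auto simp: update_matrix_def Let_def)

lemma det_update_matrix_nonzero:
  assumes "0 < d" "A \<in> carrier_mat d d" "x \<in> carrier_vec d" "det A \<noteq> 0"
  shows "det (update_matrix d A x) \<noteq> 0"
proof -
  obtain e s where "e \<in> carrier_vec d" "e \<bullet> e = 1" "1 \<le> s"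
    "update_matrix d A x = stretch d e (1 / s - 1) * A"
    using update_matrixE[OF assms(1-3)] .
  then show ?thesis using det_stretch_nonzero[of e d s] assms det_mult[of "stretch d e (1 / s - 1)" d A] by simp
qed

lemma frob_stretch_contraction_le:
  assumes D: "D \<in> carrier_mat d d" and contr: "\<And>z. z \<in> carrier_vec d \<Longrightarrow> enorm (D *\<^sub>v z) \<le> enorm z"
    and e: "e \<in> carrier_vec d" "e \<bullet> e = 1" and De: "s * enorm (D *\<^sub>v e) \<le> 1" and s: "1 \<le> s"
  shows "frob d (D * stretch d e (s - 1)) \<le> d"
proof -
  \<comment> \<open>$I - e e^T$ projects $D$ to the complement of $e$, where a contraction has squared Frobenius norm at most $d - 1$\<close>
  have "frob d D - (enorm (D *\<^sub>v e))\<^sup>2 = frob d (D * stretch d e (-1))"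
    by (simp add: frob_mult_stretch[OF D e])
  also have "\<dots> = (\<Sum>j<d. (enorm (D *\<^sub>v col (stretch d e (-1)) j))\<^sup>2)"
    using D by (subst frob_eq_sum_cols) (auto intro!: sum.cong simp: col_mult2[of _ d d _ d])
  also have "\<dots> \<le> (\<Sum>j<d. (enorm (col (stretch d e (-1)) j))\<^sup>2)"
    by (intro sum_mono power_mono contr enorm_ge_0) (auto simp: stretch_def)
  also have "\<dots> = real d - 1"
    by (simp add: frob_stretch[OF e] flip: frob_eq_sum_cols[OF stretch_carrier])
  finally have "frob d D \<le> real d - 1 + (enorm (D *\<^sub>v e))\<^sup>2" by simp
  \<comment> \<open>The stretch multiplies the share |D e|^2 of the direction \<open>e\<close> by
    s^2, which keeps it at most 1; together with d - 1 for the complement this is d.\<close>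
  moreover have "(s * enorm (D *\<^sub>v e))\<^sup>2 \<le> 1"
    using De s by (intro power_le_one) (auto simp: enorm_ge_0)
  moreover have k: "2 * (s - 1) + (s - 1)\<^sup>2 = s\<^sup>2 - 1" by (simp add: power2_eq_square algebra_simps)
  ultimately show ?thesis
    unfolding frob_mult_stretch[OF D e] k by (simp add: left_diff_distrib power_mult_distrib)
qed

text \<open>In the coordinates of \<open>A\<close> the smaller ellipsoid is the unit ball, so
  containment says that \<open>D\<close> maps the unit ball into itself. Invertibility of
  \<open>A\<close> makes every unit vector available, and homogeneity does the rest.\<close>

lemma contraction_if_ellipsoid_subset:
  assumes A: "A \<in> carrier_mat d d" "det A \<noteq> 0" and D: "D \<in> carrier_mat d d"
    and sub: "mat_ellipsoid d A \<subseteq> mat_ellipsoid d (D * A)" and z: "z \<in> carrier_vec d"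
  shows "enorm (D *\<^sub>v z) \<le> enorm z"
proof (cases "enorm z = 0")
  case True
  moreover have "D *\<^sub>v 0\<^sub>v d = 0\<^sub>v d" using D by (intro eq_vecI) auto
  ultimately show ?thesis by (simp add: enorm_eq_0_iff[OF z])
next
  case False
  then have pos: "enorm z > 0" using enorm_ge_0[of z] by simp
  obtain A' where A': "A' \<in> carrier_mat d d" "A * A' = 1\<^sub>m d"
    using inverse_matE[OF A] by metis
  define u where "u = A' *\<^sub>v ((1 / enorm z) \<cdot>\<^sub>v z)"
  have u: "u \<in> carrier_vec d" using A' z by (simp add: u_def)
  have Au: "A *\<^sub>v u = (1 / enorm z) \<cdot>\<^sub>v z"
    using A A' z by (simp add: u_def flip: assoc_mult_mat_vec[of _ d d _ d])
  then have "u \<in> mat_ellipsoid d A" using u pos by (simp add: mat_ellipsoid_def enorm_smult)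
  then have "enorm (D *\<^sub>v (A *\<^sub>v u)) \<le> 1"
    using sub u A D by (auto simp: mat_ellipsoid_def)
  then show ?thesis using pos D z by (simp add: Au mult_mat_vec[of _ d d] enorm_smult field_simps)
qed

text \<open>In the coordinates of \<open>A\<close> the old ellipsoid is the unit ball, which the
  stretch contracts, and a point outside it is s e, which the stretch moves to e.\<close>

lemma update_matrix_contains:
  assumes d: "0 < d" and A: "A \<in> carrier_mat d d" and x: "x \<in> carrier_vec d"
  shows "insert x (mat_ellipsoid d A) \<subseteq> mat_ellipsoid d (update_matrix d A x)"
proof -
  obtain e s where e: "e \<in> carrier_vec d" "e \<bullet> e = 1" and s: "1 \<le> s"
    and upd: "update_matrix d A x = stretch d e (1 / s - 1) * A"
    and y: "s = 1 \<and> enorm (A *\<^sub>v x) \<le> 1 \<or> A *\<^sub>v x = s \<cdot>\<^sub>v e"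
    using update_matrixE[OF d A x] .
  have en: "enorm e = 1" using e by (simp add: enorm_def)
  have mv: "update_matrix d A x *\<^sub>v v = stretch d e (1 / s - 1) *\<^sub>v (A *\<^sub>v v)" if "v \<in> carrier_vec d" for v
    using that A by (simp add: upd assoc_mult_mat_vec[of _ d d _ d])
  have "enorm (update_matrix d A x *\<^sub>v x) \<le> 1"
    using y
  proof
    assume "s = 1 \<and> enorm (A *\<^sub>v x) \<le> 1"
    then show ?thesis using A x by (simp add: mv[OF x] stretch_0)
  next
    assume y: "A *\<^sub>v x = s \<cdot>\<^sub>v e"
    have "stretch d e (1 / s - 1) *\<^sub>v (s \<cdot>\<^sub>v e) = e"
      using e s by (subst stretch_mult_vec)
       (auto intro!: eq_vecI simp: field_simps)
    then show ?thesis by (simp add: mv[OF x] y en)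
  qed
  moreover have "enorm (update_matrix d A x *\<^sub>v v) \<le> 1" if "v \<in> mat_ellipsoid d A" for v
    using that s stretch_contraction[OF e, of "A *\<^sub>v v" "1 / s - 1"] A
    by (auto simp: mat_ellipsoid_def mv)
  ultimately show ?thesis using x by (auto simp: mat_ellipsoid_def)
qed

text \<open>Updating \<open>A\<close> turns the quotient D = B A^{-1} into
  \<open>D * stretch d e (s - 1)\<close>. Both the optimality proof and the potential argument
  follow this quotient.\<close>

lemma mult_update_matrix:
  fixes D :: "real mat"
  assumes e: "e \<in> carrier_vec d" "e \<bullet> e = 1" "1 \<le> s" and A: "A \<in> carrier_mat d d" and D: "D \<in> carrier_mat d d"
  shows "(D * stretch d e (s - 1)) * (stretch d e (1 / s - 1) * A) = D * A"
proof -
  have "(D * stretch d e (s - 1)) * (stretch d e (1 / s - 1) * A)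
      = D * ((stretch d e (s - 1) * stretch d e (1 / s - 1)) * A)"
    by (simp add: assoc_mult_mat[OF D stretch_carrier mult_carrier_mat[OF stretch_carrier A]]
        assoc_mult_mat[OF stretch_carrier stretch_carrier A])
  then show ?thesis using stretch_inverse[OF e(1,2)] e(3) A by simp
qed

lemma update_matrix_optimal:
  assumes d: "0 < d" and A: "A \<in> carrier_mat d d" "det A \<noteq> 0" and x: "x \<in> carrier_vec d"
    and B: "B \<in> carrier_mat d d" "det B \<noteq> 0"
    and sub: "insert x (mat_ellipsoid d A) \<subseteq> mat_ellipsoid d B"
  shows "\<bar>det B\<bar> \<le> \<bar>det (update_matrix d A x)\<bar>"
    and "\<bar>det B\<bar> = \<bar>det (update_matrix d A x)\<bar> \<Longrightarrow> mat_ellipsoid d B = mat_ellipsoid d (update_matrix d A x)"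
proof -
  obtain e s where e: "e \<in> carrier_vec d" "e \<bullet> e = 1" and s: "1 \<le> s"
    and upd: "update_matrix d A x = stretch d e (1 / s - 1) * A"
    and y: "s = 1 \<and> enorm (A *\<^sub>v x) \<le> 1 \<or> A *\<^sub>v x = s \<cdot>\<^sub>v e"
    using update_matrixE[OF d A(1) x] .
  obtain A' where A': "A' \<in> carrier_mat d d" "A' * A = 1\<^sub>m d" using inverse_matE[OF A] by metis
  define D where "D = B * A'"
  have D: "D \<in> carrier_mat d d" using A' B by (simp add: D_def)
  have DA: "D * A = B" using A A' B by (simp add: D_def assoc_mult_mat[of _ d d _ d _ d])
  have contr: "enorm (D *\<^sub>v z) \<le> enorm z" if "z \<in> carrier_vec d" for z
    by (rule contraction_if_ellipsoid_subset[OF A D _ that]) (use sub DA in auto)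
  \<comment> \<open>An uncovered \<open>x\<close> is s e in the coordinates of \<open>A\<close>,
    hence |B x| = s |D e|; for a point already covered, s = 1 and the contraction suffices.\<close>
  have De: "s * enorm (D *\<^sub>v e) \<le> 1"
    using y
  proof
    assume "s = 1 \<and> enorm (A *\<^sub>v x) \<le> 1"
    then show ?thesis using contr[OF e(1)] e by (simp add: enorm_def)
  next
    assume y: "A *\<^sub>v x = s \<cdot>\<^sub>v e"
    have "B *\<^sub>v x = D *\<^sub>v (A *\<^sub>v x)" using A D x by (simp flip: DA)
    then have "enorm (B *\<^sub>v x) = s * enorm (D *\<^sub>v e)"
      using D e s by (simp add: y mult_mat_vec[of _ d d] enorm_smult)
    then show ?thesis using sub by (simp add: mat_ellipsoid_def)
  qed
  define C where "C = D * stretch d e (s - 1)"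
  let ?U = "update_matrix d A x"
  have C: "C \<in> carrier_mat d d" using D by (simp add: C_def)
  have U: "?U \<in> carrier_mat d d" "det ?U \<noteq> 0"
    using update_matrix_carrier[OF A(1)] det_update_matrix_nonzero[OF d A(1) x A(2)] by auto
  have CU: "C * ?U = B" unfolding C_def upd mult_update_matrix[OF e s A(1) D] DA ..
  then have detB: "det B = det C * det ?U" using det_mult[OF C U(1)] by simp
  then have detC: "det C \<noteq> 0" using B by auto
  have frob: "frob d C \<le> d"
    unfolding C_def by (rule frob_stretch_contraction_le[OF D contr e De s])
  then have "ln ((det C)\<^sup>2) \<le> 0" using ln_det_le_frob(1)[OF C detC] by simp
  then have "(det C)\<^sup>2 \<le> 1" using detC by simp
  then have "\<bar>det C\<bar> \<le> 1" by (simp add: abs_square_le_1)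
  then show "\<bar>det B\<bar> \<le> \<bar>det ?U\<bar>"
    using mult_right_mono[of "\<bar>det C\<bar>" 1 "\<bar>det ?U\<bar>"] by (simp add: detB abs_mult)
  assume "\<bar>det B\<bar> = \<bar>det ?U\<bar>"
  then have "\<bar>det C\<bar> = 1" using U by (simp add: detB abs_mult)
  then have "(det C)\<^sup>2 = 1" by (simp add: abs_square_eq_1)
  \<comment> \<open>The equality case of AM-GM: 0 = ln (det C)^2 <= ||C||_F^2 - d <= 0. It makes
    \<open>C\<close> an isometry, so \<open>B\<close> and the update may differ as matrices but
    define the same ellipsoid.\<close>
  then have "ln ((det C)\<^sup>2) = frob d C - d" using frob ln_det_le_frob(1)[OF C detC] by simp
  then have "enorm (C *\<^sub>v v) = enorm v" if "v \<in> carrier_vec d" for v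
    using ln_det_le_frob(2)[OF C detC] that by blast
  then have "enorm (B *\<^sub>v v) = enorm (?U *\<^sub>v v)" if "v \<in> carrier_vec d" for v
    using C U(1) that by (simp flip: CU)
  then show "mat_ellipsoid d B = mat_ellipsoid d ?U" by (auto simp: mat_ellipsoid_def)
qed

text \<open>The update is a minimizer, so any other one has the same |det|, and the equality case of
  optimality identifies the two ellipsoids.\<close>

lemma min_volume_ellipsoid_iff_update:
  assumes d: "0 < d" and A: "A \<in> carrier_mat d d" "det A \<noteq> 0" and x: "x \<in> carrier_vec d"
  shows "min_volume_ellipsoid d (insert x (mat_ellipsoid d A)) G \<longleftrightarrow> G = mat_ellipsoid d (update_matrix d A x)"
proof -
  let ?U = "update_matrix d A x"
  have U: "?U \<in> carrier_mat d d" "det ?U \<noteq> 0"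
    using update_matrix_carrier[OF A(1)] det_update_matrix_nonzero[OF d A(1) x A(2)] by auto
  have contains: "insert x (mat_ellipsoid d A) \<subseteq> mat_ellipsoid d ?U"
    using update_matrix_contains[OF d A(1) x] .
  have ell: "ellipsoid d (mat_ellipsoid d ?U)" using U by (auto simp: ellipsoid_def)
  show ?thesis
  proof
    assume G: "min_volume_ellipsoid d (insert x (mat_ellipsoid d A)) G"
    then obtain B where B: "B \<in> carrier_mat d d" "det B \<noteq> 0" "G = mat_ellipsoid d B"
      by (auto simp: min_volume_ellipsoid_def ellipsoid_def)
    have sub: "insert x (mat_ellipsoid d A) \<subseteq> mat_ellipsoid d B"
      and "volume d (mat_ellipsoid d B) \<le> volume d (mat_ellipsoid d ?U)"
      using G contains ell by (auto simp: min_volume_ellipsoid_def B(3))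
    then have "\<bar>det ?U\<bar> \<le> \<bar>det B\<bar>" using volume_le_iff_det_ge[OF B(1,2) U] by simp
    then show "G = mat_ellipsoid d ?U"
      using update_matrix_optimal[OF d A x B(1,2) sub] B(3) by simp
  next
    assume G: "G = mat_ellipsoid d ?U"
    have "volume d (mat_ellipsoid d ?U) \<le> volume d F"
      if F: "ellipsoid d F" "insert x (mat_ellipsoid d A) \<subseteq> F" for F
    proof -
      obtain B where B: "B \<in> carrier_mat d d" "det B \<noteq> 0" "F = mat_ellipsoid d B"
        using F(1) unfolding ellipsoid_def by blast
      then show ?thesis
        using update_matrix_optimal(1)[OF d A x B(1,2)] volume_le_iff_det_ge[OF U B(1,2)] F by simp
    qed
    then show "min_volume_ellipsoid d (insert x (mat_ellipsoid d A)) G"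
      using contains ell by (auto simp: min_volume_ellipsoid_def G)
  qed
qed

lemma scale_dep_matrix_carrier: "scale_dep_matrix d r x t \<in> carrier_mat d d"
  by (induction t) (auto simp: update_matrix_carrier)

lemma det_scale_dep_matrix_nonzero:
  assumes "0 < d" "0 < r" "\<forall>t\<in>{1..n}. x t \<in> carrier_vec d" "t \<le> n"
  shows "det (scale_dep_matrix d r x t) \<noteq> 0"
  using assms(4)
proof (induction t)
  case 0
  then show ?case using assms(2) by (simp add: det_smult)
next
  case (Suc t)
  then show ?case using assms det_update_matrix_nonzero[OF assms(1) scale_dep_matrix_carrier] by simp
qed

lemma euclid_ball_eq_mat_ellipsoid:
  assumes "0 < r"
  shows "euclid_ball d r = mat_ellipsoid d ((1 / r) \<cdot>\<^sub>m 1\<^sub>m d)"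
proof -
  have "((1 / r) \<cdot>\<^sub>m 1\<^sub>m d) *\<^sub>v v = (1 / r) \<cdot>\<^sub>v v" if "v \<in> carrier_vec d" for v
    using that by (intro eq_vecI) auto
  then show ?thesis using assms by (auto simp: euclid_ball_def mat_ellipsoid_def enorm_smult)
qed

text \<open>Uniqueness of the minimizer makes the relation deterministic, so a run is forced to
  follow the matrix recursion. Beyond index \<open>n\<close> the sequence \<open>E\<close> is
  unconstrained, hence the bound on \<open>t\<close>.\<close>

lemma scale_dep_run_iff:
  assumes d: "0 < d" and r: "0 < r" and x: "\<forall>t\<in>{1..n}. x t \<in> carrier_vec d"
  shows "scale_dep_run d r x n E \<longleftrightarrow> (\<forall>t\<le>n. E t = mat_ellipsoid d (scale_dep_matrix d r x t))"
proof -
  have step: "min_volume_ellipsoid d (insert (x (Suc t)) (mat_ellipsoid d (scale_dep_matrix d r x t))) G \<longleftrightarrow>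
      G = mat_ellipsoid d (scale_dep_matrix d r x (Suc t))" if "Suc t \<le> n" for t G
  proof -
    have "det (scale_dep_matrix d r x t) \<noteq> 0" "x (Suc t) \<in> carrier_vec d"
      using det_scale_dep_matrix_nonzero[OF d r x, of t] that x by auto
    then show ?thesis using min_volume_ellipsoid_iff_update[OF d scale_dep_matrix_carrier] by simp
  qed
  show ?thesis
  proof
    assume run: "scale_dep_run d r x n E"
    have "t \<le> n \<longrightarrow> E t = mat_ellipsoid d (scale_dep_matrix d r x t)" for t
    proof (induction t)
      case 0
      then show ?case using run euclid_ball_eq_mat_ellipsoid[OF r] by (simp add: scale_dep_run_def)
    next
      case (Suc t)
      show ?case
      proof
        assume t: "Suc t \<le> n"
        then have "min_volume_ellipsoid d (insert (x (Suc t)) (E t)) (E (Suc t))"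
          using run unfolding scale_dep_run_def by (force dest!: bspec[of _ _ "Suc t"])
        then show "E (Suc t) = mat_ellipsoid d (scale_dep_matrix d r x (Suc t))"
          using Suc t step[OF t] by simp
      qed
    qed
    then show "\<forall>t\<le>n. E t = mat_ellipsoid d (scale_dep_matrix d r x t)" by blast
  next
    assume E: "\<forall>t\<le>n. E t = mat_ellipsoid d (scale_dep_matrix d r x t)"
    have "min_volume_ellipsoid d (insert (x t) (E (t - 1))) (E t)" if t: "t \<in> {1..n}" for t
    proof -
      obtain t' where t': "t = Suc t'" using t by (cases t) auto
      then show ?thesis using step[of t' "E t"] t E by simp
    qed
    then show "scale_dep_run d r x n E"
      using E euclid_ball_eq_mat_ellipsoid[OF r] by (simp add: scale_dep_run_def)
  qed
qed

section \<open>The potential argument\<close>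

lemma det_smult_square:
  "A \<in> carrier_mat d d \<Longrightarrow> (det (c \<cdot>\<^sub>m A))\<^sup>2 = (c\<^sup>2) ^ d * (det A)\<^sup>2" for A :: "real mat"
  by (simp add: det_smult power_mult_distrib flip: power_mult) (simp add: mult.commute)

lemma frob_smult: "A \<in> carrier_mat d d \<Longrightarrow> frob d (c \<cdot>\<^sub>m A) = c\<^sup>2 * frob d A"
  by (simp add: frob_def power_mult_distrib sum_distrib_left)

text \<open>AM-GM applied to $D / sqrt 2$.\<close>

lemma ln_det_le_half_frob:
  assumes D: "D \<in> carrier_mat d d" "det D \<noteq> 0"
  shows "ln ((det D)\<^sup>2) \<le> frob d D / 2"
proof -
  \<comment> \<open>Halving the squared norm limits the logarithm to half of ||D||_F^2, so the other
    half of the potential remains to bound the norm itself.\<close>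
  let ?C = "sqrt (1 / 2) \<cdot>\<^sub>m D"
  have C: "?C \<in> carrier_mat d d" "det ?C \<noteq> 0" using D by (simp_all add: det_smult)
  have "ln ((det ?C)\<^sup>2) = ln ((1 / 2) ^ d) + ln ((det D)\<^sup>2)"
    unfolding det_smult_square[OF D(1)] using D by (subst ln_mult) auto
  also have "ln ((1 / 2 :: real) ^ d) = - (real d * ln 2)" by (simp add: ln_realpow ln_div)
  finally have "ln ((det D)\<^sup>2) = ln ((det ?C)\<^sup>2) + real d * ln 2" by simp
  moreover have "ln ((det ?C)\<^sup>2) \<le> frob d D / 2 - d"
    using ln_det_le_frob(1)[OF C] by (simp add: frob_smult[OF D(1)])
  \<comment> \<open>The d ln 2 caused by the scaling is absorbed by the -d of AM-GM.\<close>
  moreover have "real d * ln 2 \<le> real d"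
    using ln_le_minus_one[of "2::real"] mult_left_mono[of "ln 2" "1::real" "real d"] by simp
  ultimately show ?thesis by linarith
qed

lemma potential_update_le:
  assumes d: "0 < d" and A: "A \<in> carrier_mat d d" "det A \<noteq> 0" and x: "x \<in> carrier_vec d"
    and D: "D \<in> carrier_mat d d" "det D \<noteq> 0" and Bx: "enorm ((D * A) *\<^sub>v x) \<le> 1"
  obtains D' where "D' \<in> carrier_mat d d" "det D' \<noteq> 0" "D' * update_matrix d A x = D * A"
    "frob d D' - ln ((det D')\<^sup>2) \<le> frob d D - ln ((det D)\<^sup>2)"
proof -
  obtain e s where e: "e \<in> carrier_vec d" "e \<bullet> e = 1" and s: "1 \<le> s"
    and upd: "update_matrix d A x = stretch d e (1 / s - 1) * A"
    and y: "s = 1 \<and> enorm (A *\<^sub>v x) \<le> 1 \<or> A *\<^sub>v x = s \<cdot>\<^sub>v e"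
    using update_matrixE[OF d A(1) x] .
  let ?S = "stretch d e (s - 1)" and ?T = "stretch d e (1 / s - 1)"
  have detT: "det ?T \<noteq> 0" using det_stretch_nonzero[OF e, of s] s by simp
  have detST: "det ?S * det ?T = 1"
    using det_mult[OF stretch_carrier stretch_carrier, of d e "s - 1" e "1 / s - 1"] stretch_inverse[OF e, of s] s
    by simp
  then have detS: "det ?S \<noteq> 0" by auto
  \<comment> \<open>AM-GM for the inverse bounds the growth of the determinant without computing it\<close>
  have "2 * (1 / s - 1) + (1 / s - 1)\<^sup>2 = 1 / s\<^sup>2 - 1"
    by (simp add: power2_eq_square algebra_simps)
  then have "ln ((det ?T)\<^sup>2) \<le> 1 / s\<^sup>2 - 1"
    using ln_det_le_frob(1)[OF stretch_carrier detT] frob_stretch[OF e, of "1 / s - 1"] by simp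
  moreover have "ln ((det ?S)\<^sup>2 * (det ?T)\<^sup>2) = 0"
    by (simp add: detST flip: power_mult_distrib)
  then have "ln ((det ?S)\<^sup>2) + ln ((det ?T)\<^sup>2) = 0"
    using detS detT by (simp add: ln_mult)
  ultimately have lnS: "ln ((det ?S)\<^sup>2) \<ge> 1 - 1 / s\<^sup>2" by simp
  \<comment> \<open>\<open>x\<close> lies in the target ellipsoid, so s |D e| <= 1 for an uncovered
    \<open>x\<close>, and the Frobenius increase is at most (s^2 - 1) / s^2, just what
    \<open>lnS\<close> guarantees for the logarithm. For s = 1 both sides vanish.\<close>
  have De: "(s\<^sup>2 - 1) * (enorm (D *\<^sub>v e))\<^sup>2 \<le> 1 - 1 / s\<^sup>2"
    using y
  proof
    assume y: "A *\<^sub>v x = s \<cdot>\<^sub>v e"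
    have "enorm ((D * A) *\<^sub>v x) = s * enorm (D *\<^sub>v e)"
      using D A x e s by (simp add: assoc_mult_mat_vec[of _ d d _ d] y mult_mat_vec[of _ d d] enorm_smult)
    then have "(s * enorm (D *\<^sub>v e))\<^sup>2 \<le> 1"
      using Bx s by (intro power_le_one) (auto simp: enorm_ge_0)
    then have "(enorm (D *\<^sub>v e))\<^sup>2 \<le> 1 / s\<^sup>2" using s by (simp add: field_simps power_mult_distrib)
    then have "(s\<^sup>2 - 1) * (enorm (D *\<^sub>v e))\<^sup>2 \<le> (s\<^sup>2 - 1) * (1 / s\<^sup>2)"
      using s by (intro mult_left_mono) auto
    also have "\<dots> = 1 - 1 / s\<^sup>2" using s by (simp add: field_simps)
    finally show ?thesis .
  qed auto
  show ?thesis
  proof (rule that[of "D * ?S"])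
    show "D * ?S \<in> carrier_mat d d" using D by simp
    show "det (D * ?S) \<noteq> 0" using D detS by (simp add: det_mult[of _ d])
    show "(D * ?S) * update_matrix d A x = D * A"
      unfolding upd by (rule mult_update_matrix[OF e s A(1) D(1)])
    have "2 * (s - 1) + (s - 1)\<^sup>2 = s\<^sup>2 - 1" by (simp add: power2_eq_square algebra_simps)
    then have "frob d (D * ?S) = frob d D + (s\<^sup>2 - 1) * (enorm (D *\<^sub>v e))\<^sup>2"
      using frob_mult_stretch[OF D(1) e, of "s - 1"] by simp
    moreover have "ln ((det (D * ?S))\<^sup>2) = ln ((det D)\<^sup>2) + ln ((det ?S)\<^sup>2)"
      using D detS by (simp add: det_mult[of _ d] power_mult_distrib ln_mult)
    ultimately show "frob d (D * ?S) - ln ((det (D * ?S))\<^sup>2) \<le> frob d D - ln ((det D)\<^sup>2)"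
      using De lnS by linarith
  qed
qed

text \<open>Here $D = B A_t^{-1}$.\<close>

lemma potential_scale_dep_matrix:
  assumes d: "0 < d" and r: "0 < r" and x: "\<forall>t\<in>{1..n}. x t \<in> carrier_vec d"
    and B: "B \<in> carrier_mat d d" "det B \<noteq> 0" and Bx: "\<forall>t\<in>{1..n}. enorm (B *\<^sub>v x t) \<le> 1"
    and "t \<le> n"
  shows "\<exists>D\<in>carrier_mat d d. det D \<noteq> 0 \<and> D * scale_dep_matrix d r x t = B \<and>
    frob d D - ln ((det D)\<^sup>2) \<le> frob d (r \<cdot>\<^sub>m B) - ln ((det (r \<cdot>\<^sub>m B))\<^sup>2)"
  using \<open>t \<le> n\<close>
proof (induction t)
  case 0
  \<comment> \<open>Since A_0 = I / r, the initial quotient B A_0^{-1} is r B.\<close>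
  have "(r \<cdot>\<^sub>m B) * ((1 / r) \<cdot>\<^sub>m 1\<^sub>m d) = B"
    using B r by (intro eq_matI) (auto simp: mult_smult_assoc_mat[of _ d d _ d] mult_smult_distrib[of _ d d _ d])
  then show ?case using B r by (intro bexI[of _ "r \<cdot>\<^sub>m B"]) (auto simp: det_smult)
next
  case (Suc t)
  let ?A = "scale_dep_matrix d r x t"
  obtain D where D: "D \<in> carrier_mat d d" "det D \<noteq> 0" "D * ?A = B"
    "frob d D - ln ((det D)\<^sup>2) \<le> frob d (r \<cdot>\<^sub>m B) - ln ((det (r \<cdot>\<^sub>m B))\<^sup>2)"
    using Suc by auto
  have "x (Suc t) \<in> carrier_vec d" "enorm ((D * ?A) *\<^sub>v x (Suc t)) \<le> 1"
    using Suc.prems x Bx D(3) by auto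
  then obtain D' where "D' \<in> carrier_mat d d" "det D' \<noteq> 0" "D' * update_matrix d ?A (x (Suc t)) = D * ?A"
    "frob d D' - ln ((det D')\<^sup>2) \<le> frob d D - ln ((det D)\<^sup>2)"
    using potential_update_le[OF d scale_dep_matrix_carrier det_scale_dep_matrix_nonzero[OF d r x]] D(1,2) Suc.prems
    by (metis Suc_leD)
  then show ?case using D by (intro bexI[of _ D']) auto
qed

section \<open>Convex hulls, principal axes and the approximation bound\<close>

lemma linear_functional_conv_hull_le:
  assumes u: "u \<in> carrier_vec d" and v: "v \<in> conv_hull d S" and S: "S \<subseteq> carrier_vec d"
    and le: "\<And>w. w \<in> S \<Longrightarrow> u \<bullet> w \<le> c"
  shows "u \<bullet> v \<le> c"
proof -
  obtain F p where F: "finite F" "F \<subseteq> S" "\<forall>w\<in>F. 0 \<le> p w" "(\<Sum>w\<in>F. p w) = (1::real)"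
    and v: "v = vec d (\<lambda>i. \<Sum>w\<in>F. p w * w $ i)"
    using v by (auto simp: conv_hull_def)
  have "u \<bullet> v = (\<Sum>i<d. \<Sum>w\<in>F. p w * (u $ i * w $ i))"
    by (subst scalar_prod_eq_sum[of _ d]) (auto simp: v sum_distrib_left mult_ac intro!: sum.cong)
  also have "\<dots> = (\<Sum>w\<in>F. p w * (u \<bullet> w))"
    using F S by (subst sum.swap) (auto simp: scalar_prod_eq_sum[of _ d] sum_distrib_left intro!: sum.cong)
  also have "\<dots> \<le> (\<Sum>w\<in>F. p w * c)"
    using F le by (intro sum_mono mult_left_mono) auto
  also have "\<dots> = c" using F by (simp flip: sum_distrib_right)
  finally show ?thesis .
qed

lemma mem_conv_hull:
  assumes "v \<in> S" "v \<in> carrier_vec d"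
  shows "v \<in> conv_hull d S"
proof -
  have "v = vec d (\<lambda>i. \<Sum>w\<in>{v}. 1 * w $ i)" using assms by auto
  then show ?thesis unfolding conv_hull_def using assms
    by (intro CollectI exI[of _ "{v}"] exI[of _ "\<lambda>_. 1"]) auto
qed

text \<open>\<open>B\<close> has the rows u_i / a_i, a diagonal matrix times an orthogonal one, and
  maps the ellipsoid to the unit ball along its principal axes. Its norm and determinant, which
  enter the initial potential, become explicit in the semi-axes.\<close>

lemma semi_axes_matrixE:
  assumes "has_semi_axes d E u a"
  obtains B where "B \<in> carrier_mat d d" "E = mat_ellipsoid d B"
    "frob d B = (\<Sum>i<d. (1 / a i)\<^sup>2)" "(det B)\<^sup>2 = (\<Prod>i<d. (1 / a i)\<^sup>2)"
    "\<And>i v. i < d \<Longrightarrow> v \<in> carrier_vec d \<Longrightarrow> (B *\<^sub>v v) $ i = (u i \<bullet> v) / a i"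
    "\<And>v. v \<in> carrier_vec d \<Longrightarrow> (enorm (B *\<^sub>v v))\<^sup>2 = (\<Sum>i<d. ((u i \<bullet> v) / a i)\<^sup>2)"
    "\<And>v. v \<in> carrier_vec d \<Longrightarrow> (\<Sum>i<d. (u i \<bullet> v)\<^sup>2) = (enorm v)\<^sup>2"
proof -
  have u: "u i \<in> carrier_vec d" "0 < a i" if "i < d" for i
    using assms that by (auto simp: has_semi_axes_def)
  have ortho: "u i \<bullet> u j = (if i = j then 1 else 0)" if "i < d" "j < d" for i j
    using assms that by (auto simp: has_semi_axes_def)
  have E: "E = {v \<in> carrier_vec d. (\<Sum>i<d. ((u i \<bullet> v) / a i)\<^sup>2) \<le> 1}"
    using assms by (simp add: has_semi_axes_def)
  define U where "U = mat d d (\<lambda>(i, j). u i $ j)"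
  have U: "U \<in> carrier_mat d d" by (simp add: U_def)
  have rowU: "row U i = u i" if "i < d" for i using that u(1)[OF that] by (intro eq_vecI) (auto simp: U_def)
  have UUT: "U * U\<^sup>T = 1\<^sub>m d"
  proof (rule eq_matI)
    fix i j assume "i < dim_row (1\<^sub>m d)" "j < dim_col (1\<^sub>m d)"
    then have ij: "i < d" "j < d" by simp_all
    then show "(U * U\<^sup>T) $$ (i, j) = 1\<^sub>m d $$ (i, j)" using U by (simp add: rowU ortho)
  qed (use U in auto)
  define S where "S = mat d d (\<lambda>(i, j). if i = j then 1 / a i else 0)"
  have S: "S \<in> carrier_mat d d" by (simp add: S_def)
  define B where "B = S * U"
  have B: "B \<in> carrier_mat d d" using S U by (simp add: B_def)
  have Bij: "B $$ (i, j) = u i $ j / a i" if "i < d" "j < d" for i j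
  proof -
    have "B $$ (i, j) = (\<Sum>k<d. if k = i then u i $ j / a i else 0)"
      unfolding B_def mult_mat_index[OF S U that] using that
      by (intro sum.cong) (auto simp: S_def U_def)
    then show ?thesis using that by simp
  qed
  have Bv: "(B *\<^sub>v v) $ i = (u i \<bullet> v) / a i" if "i < d" "v \<in> carrier_vec d" for i v
    unfolding mult_mat_vec_index[OF B that(2,1)] scalar_prod_eq_sum[OF that(2)] using that
    by (auto simp: Bij sum_divide_distrib intro!: sum.cong)
  have nB: "(enorm (B *\<^sub>v v))\<^sup>2 = (\<Sum>i<d. ((u i \<bullet> v) / a i)\<^sup>2)" if "v \<in> carrier_vec d" for v
    using B Bv that by (subst enorm_power2_sum[of _ d]) (auto simp del: index_mult_mat_vec)
  show ?thesis
  proof (rule that[of B])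
    have "enorm (B *\<^sub>v v) \<le> 1 \<longleftrightarrow> (\<Sum>i<d. ((u i \<bullet> v) / a i)\<^sup>2) \<le> 1" if "v \<in> carrier_vec d" for v
      unfolding nB[OF that, symmetric] using enorm_ge_0[of "B *\<^sub>v v"] by (simp add: abs_square_le_1)
    then show "E = mat_ellipsoid d B" unfolding E mat_ellipsoid_def by blast
    have "(\<Sum>j<d. (B $$ (i, j))\<^sup>2) = (1 / a i)\<^sup>2" if i: "i < d" for i
    proof -
      have "(\<Sum>j<d. (B $$ (i, j))\<^sup>2) = (1 / a i)\<^sup>2 * (u i \<bullet> u i)"
        unfolding scalar_prod_eq_sum[OF u(1)[OF i]] sum_distrib_left using i
        by (intro sum.cong) (auto simp: Bij power2_eq_square)
      then show ?thesis using ortho[OF i i] by simp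
    qed
    then show "frob d B = (\<Sum>i<d. (1 / a i)\<^sup>2)" by (simp add: frob_def)
    have "det S = (\<Prod>i<d. 1 / a i)"
      using det_lower_triangular[OF _ S] by (simp add: S_def prod_list_diag_prod lessThan_atLeast0)
    then show "(det B)\<^sup>2 = (\<Prod>i<d. (1 / a i)\<^sup>2)"
      using det_mult[OF S U] orthogonal_matD(2)[OF U UUT]
      by (simp add: B_def power_mult_distrib prod_power_distrib)
    show "(\<Sum>i<d. (u i \<bullet> v)\<^sup>2) = (enorm v)\<^sup>2" if "v \<in> carrier_vec d" for v
    proof -
      have "(enorm (U *\<^sub>v v))\<^sup>2 = (\<Sum>i<d. (u i \<bullet> v)\<^sup>2)"
        using U rowU that by (subst enorm_power2_sum[of _ d]) auto
      then show ?thesis using orthogonal_matD(1)[OF U UUT that] by simp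
    qed
  qed (use B Bv nB in auto)
qed

lemma enorm_smult_mat_mult_vec:
  "B \<in> carrier_mat d d \<Longrightarrow> v \<in> carrier_vec d \<Longrightarrow> enorm ((c \<cdot>\<^sub>m B) *\<^sub>v v) = \<bar>c\<bar> * enorm (B *\<^sub>v v)"
proof -
  assume "B \<in> carrier_mat d d" "v \<in> carrier_vec d"
  then have "(c \<cdot>\<^sub>m B) *\<^sub>v v = c \<cdot>\<^sub>v (B *\<^sub>v v)" by (intro eq_vecI) auto
  then show ?thesis by (simp add: enorm_smult)
qed

lemma scale_dep_run_approximation:
  assumes d: "0 < d" and x: "\<forall>t\<in>{1..n}. x t \<in> carrier_vec d" and r: "0 < r"
    and ball: "euclid_ball d r \<subseteq> conv_hull d (\<Union>t\<in>{1..n}. {x t, - x t})"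
    and R: "R = Max ((\<lambda>t. enorm (x t)) ` {1..n})"
    and run: "scale_dep_run d r x n E"
    and sub: "conv_hull d (\<Union>t\<in>{1..n}. {x t, - x t}) \<subseteq> Estar"
    and aspect: "has_aspect_ratio d Estar \<kappa>" "\<kappa> \<le> R / r"
  shows "E n \<subseteq> dilate (sqrt 8 * sqrt (real d * (ln (R / r) + 1))) Estar"
proof -
  define X where "X = (\<Union>t\<in>{1..n}. {x t, - x t})"
  note ball = ball[folded X_def] and sub = sub[folded X_def]
  obtain u a where ax: "has_semi_axes d Estar u a" and \<kappa>: "\<kappa> = Max (a ` {..<d}) / Min (a ` {..<d})"
    using aspect by (auto simp: has_aspect_ratio_def)
  obtain B where B: "B \<in> carrier_mat d d" and Estar: "Estar = mat_ellipsoid d B"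
    and frobB: "frob d B = (\<Sum>i<d. (1 / a i)\<^sup>2)" and detB: "(det B)\<^sup>2 = (\<Prod>i<d. (1 / a i)\<^sup>2)"
    and Bv: "\<And>i v. i < d \<Longrightarrow> v \<in> carrier_vec d \<Longrightarrow> (B *\<^sub>v v) $ i = (u i \<bullet> v) / a i"
    and nB: "\<And>v. v \<in> carrier_vec d \<Longrightarrow> (enorm (B *\<^sub>v v))\<^sup>2 = (\<Sum>i<d. ((u i \<bullet> v) / a i)\<^sup>2)"
    and nU: "\<And>v. v \<in> carrier_vec d \<Longrightarrow> (\<Sum>i<d. (u i \<bullet> v)\<^sup>2) = (enorm v)\<^sup>2"
    by (rule semi_axes_matrixE[OF ax]) blast
  have u: "u i \<in> carrier_vec d" "u i \<bullet> u i = 1" "0 < a i" if "i < d" for i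
    using ax that by (auto simp: has_semi_axes_def)
  have X: "X \<subseteq> carrier_vec d" using x by (auto simp: X_def)
  \<comment> \<open>Without points the hull is empty and contains no ball. Positivity of
    \<open>n\<close> makes the maxima over the points meaningful.\<close>
  have n: "n > 0"
  proof (rule ccontr)
    assume "\<not> n > 0"
    then have "conv_hull d X = {}" by (auto simp: conv_hull_def X_def)
    moreover have "0\<^sub>v d \<in> euclid_ball d r" using r by (simp add: euclid_ball_def enorm_def)
    ultimately show False using ball by auto
  qed
  \<comment> \<open>$E^*$ may be much larger than the hull, so it is first shrunk until it touches a point: then its semi-axes lie between $r$ and $R^2 / r$\<close>
  define \<rho> where "\<rho> = Max ((\<lambda>t. enorm (B *\<^sub>v x t)) ` {1..n})"
  have \<rho>_ge: "enorm (B *\<^sub>v x t) \<le> \<rho>" if "t \<in> {1..n}" for t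
    using that unfolding \<rho>_def by (intro Max_ge) auto
  obtain m where m: "m \<in> {1..n}" "\<rho> = enorm (B *\<^sub>v x m)"
    using Max_in[of "(\<lambda>t. enorm (B *\<^sub>v x t)) ` {1..n}"] n unfolding \<rho>_def by fastforce
  have R_ge: "enorm (x t) \<le> R" if "t \<in> {1..n}" for t
    using that unfolding R by (intro Max_ge) auto
  have \<rho>_le_1: "\<rho> \<le> 1"
  proof -
    have "x m \<in> conv_hull d X" using m x by (intro mem_conv_hull) (auto simp: X_def)
    then have "x m \<in> Estar" using sub by auto
    then show ?thesis by (simp add: Estar mat_ellipsoid_def m)
  qed
  \<comment> \<open>Compare support functions in the direction u_i: the ball reaches r, while every
    point, lying in the shrunken ellipsoid, reaches at most \<open>\<rho> * a i\<close>.\<close>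
  have r_le: "r \<le> \<rho> * a i" if i: "i < d" for i
  proof -
    have "r \<cdot>\<^sub>v u i \<in> euclid_ball d r" using u[OF i] r by (simp add: euclid_ball_def enorm_smult enorm_def)
    then have "r \<cdot>\<^sub>v u i \<in> conv_hull d X" using ball by blast
    then have "u i \<bullet> (r \<cdot>\<^sub>v u i) \<le> \<rho> * a i"
    proof (rule linear_functional_conv_hull_le[OF u(1)[OF i] _ X])
      fix w assume "w \<in> X"
      then obtain t where t: "t \<in> {1..n}" "w = x t \<or> w = - x t" by (auto simp: X_def)
      have xt: "x t \<in> carrier_vec d" using x t by auto
      have "\<bar>(B *\<^sub>v x t) $ i\<bar> \<le> \<rho>"
        using abs_index_le_enorm[of "B *\<^sub>v x t" d i] \<rho>_ge[OF t(1)] B xt i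
        by (simp del: index_mult_mat_vec)
      then have "\<bar>u i \<bullet> x t\<bar> \<le> \<rho> * a i"
        using Bv[OF i xt] u(3)[OF i] by (simp add: field_simps)
      then have "u i \<bullet> x t \<le> \<rho> * a i" "- (u i \<bullet> x t) \<le> \<rho> * a i" by linarith+
      moreover have "u i \<bullet> (- x t) = - (u i \<bullet> x t)"
        using u(1)[OF i] xt by simp
      ultimately show "u i \<bullet> w \<le> \<rho> * a i" using t(2) by (elim disjE) simp_all
    qed
    then show ?thesis using u[OF i] by simp
  qed
  have \<rho>: "\<rho> > 0"
    using r_le[OF d] r u(3)[OF d] by (meson order.strict_trans2 zero_less_mult_pos2)
  define a0 where "a0 = Min (a ` {..<d})"
  have a0: "a0 > 0" "\<And>i. i < d \<Longrightarrow> a0 \<le> a i"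
  proof -
    have "a0 \<in> a ` {..<d}" unfolding a0_def using d by (intro Min_in) auto
    then show "a0 > 0" using u by auto
  qed (simp add: a0_def)
  \<comment> \<open>The point \<open>x m\<close> lies on the boundary of the shrunken ellipsoid, so
    its norm, at most \<open>R\<close>, is no less than the shortest semi-axis.\<close>
  have \<rho>a0: "\<rho> * a0 \<le> R"
  proof -
    have xm: "x m \<in> carrier_vec d" using x m by auto
    have "((u i \<bullet> x m) / a i)\<^sup>2 \<le> (1 / a0)\<^sup>2 * (u i \<bullet> x m)\<^sup>2" if "i < d" for i
    proof -
      have "(1 / a i)\<^sup>2 \<le> (1 / a0)\<^sup>2"
        using a0(1) a0(2)[OF that] by (intro power_mono divide_left_mono) auto
      then have "(1 / a i)\<^sup>2 * (u i \<bullet> x m)\<^sup>2 \<le> (1 / a0)\<^sup>2 * (u i \<bullet> x m)\<^sup>2"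
        by (intro mult_right_mono) auto
      then show ?thesis by (simp add: power_divide)
    qed
    then have "\<rho>\<^sup>2 \<le> (\<Sum>i<d. (1 / a0)\<^sup>2 * (u i \<bullet> x m)\<^sup>2)"
      unfolding m(2) nB[OF xm] by (intro sum_mono) simp
    also have "\<dots> = ((1 / a0) * enorm (x m))\<^sup>2"
      unfolding sum_distrib_left[symmetric] nU[OF xm] power_mult_distrib ..
    finally have "\<rho> \<le> (1 / a0) * enorm (x m)"
      by (rule power2_le_imp_le) (use a0 enorm_ge_0 in auto)
    then show ?thesis using a0 R_ge[OF m(1)] by (simp add: field_simps)
  qed
  \<comment> \<open>The aspect ratio bounds the longest semi-axis by R / r times the shortest, which
    after shrinking is at most \<open>R\<close>.\<close>
  have \<rho>a: "\<rho> * a i \<le> R\<^sup>2 / r" if i: "i < d" for i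
  proof -
    have "a i \<le> Max (a ` {..<d})" using i by (intro Max_ge) auto
    also have "\<dots> = \<kappa> * a0" using a0 by (simp add: \<kappa> a0_def[symmetric])
    also have "\<dots> \<le> R / r * a0" using mult_right_mono[OF aspect(2)] a0(1) by simp
    finally have "\<rho> * a i \<le> \<rho> * (R / r * a0)" using \<rho> by (intro mult_left_mono) auto
    also have "\<dots> = R / r * (\<rho> * a0)" by (rule mult.left_commute)
    also have "\<dots> \<le> R / r * R"
      using \<rho>a0 r R_ge[OF m(1)] enorm_ge_0[of "x m"] by (intro mult_left_mono) auto
    finally show ?thesis by (simp add: power2_eq_square)
  qed
  have R0: "R > 0" using \<rho>a0 mult_pos_pos[OF \<rho> a0(1)] by linarith
  define L where "L = ln (R / r)"
  have lnR: "ln (R\<^sup>2 / r / r) = 2 * L"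
    using R0 r by (simp add: L_def ln_div ln_mult ln_realpow power2_eq_square)
  \<comment> \<open>The lower and upper bounds on a single semi-axis squeeze out r <= R.\<close>
  have L0: "L \<ge> 0"
  proof -
    have "r \<le> R\<^sup>2 / r" using r_le[OF d] \<rho>a[OF d] by simp
    then have "1 \<le> R\<^sup>2 / r / r" using r by (simp add: field_simps)
    then show ?thesis using lnR ln_ge_zero[of "R\<^sup>2 / r / r"] by simp
  qed
  \<comment> \<open>\<open>B'\<close> is the matrix of the shrunken ellipsoid, the multiple \<rho>
    of \<open>Estar\<close>.\<close>
  define B' where "B' = (1 / \<rho>) \<cdot>\<^sub>m B"
  have detB0: "det B \<noteq> 0"
  proof -
    have "(\<Prod>i<d. (1 / a i)\<^sup>2) > 0" by (intro prod_pos) (auto dest: u(3))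
    then have "(det B)\<^sup>2 > 0" unfolding detB .
    then show ?thesis by simp
  qed
  have B': "B' \<in> carrier_mat d d" "det B' \<noteq> 0" using B detB0 \<rho> by (auto simp: B'_def det_smult)
  have B'x: "\<forall>t\<in>{1..n}. enorm (B' *\<^sub>v x t) \<le> 1"
    using \<rho>_ge \<rho> x B by (auto simp: B'_def enorm_smult_mat_mult_vec[of _ d])
  have rB': "r \<cdot>\<^sub>m B' = (r / \<rho>) \<cdot>\<^sub>m B" using B by (intro eq_matI) (auto simp: B'_def)
  have "frob d (r \<cdot>\<^sub>m B') = (\<Sum>i<d. (r / (\<rho> * a i))\<^sup>2)"
    by (simp add: rB' frob_smult[OF B] frobB sum_distrib_left power_divide power_mult_distrib)
  also have "\<dots> \<le> (\<Sum>i<d. 1)"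
    using r_le r \<rho> u(3) by (intro sum_mono power_le_one) (auto simp: field_simps)
  finally have frob0: "frob d (r \<cdot>\<^sub>m B') \<le> d" by simp
  have "(det (r \<cdot>\<^sub>m B'))\<^sup>2 = (\<Prod>i<d. (r / \<rho>)\<^sup>2 * (1 / a i)\<^sup>2)"
    unfolding rB' det_smult_square[OF B] detB prod.distrib by simp
  then have "ln ((det (r \<cdot>\<^sub>m B'))\<^sup>2) = (\<Sum>i<d. ln ((r / \<rho>)\<^sup>2 * (1 / a i)\<^sup>2))"
    using r \<rho> by (simp only:, intro ln_prod) (auto dest: u(3))
  \<comment> \<open>In units of r each semi-axis is at most (R / r)^2, with logarithm 2 L; the
    square of the determinant doubles this to 4 L.\<close>
  also have "\<dots> \<ge> (\<Sum>i<d. - (4 * L))"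
  proof (intro sum_mono)
    fix i assume "i \<in> {..<d}"
    then have i: "i < d" by simp
    have "(r / \<rho>)\<^sup>2 * (1 / a i)\<^sup>2 = (1 / (\<rho> * a i / r))\<^sup>2" by (simp add: power_divide power_mult_distrib)
    then have "ln ((r / \<rho>)\<^sup>2 * (1 / a i)\<^sup>2) = - (2 * ln (\<rho> * a i / r))"
      using \<rho> u(3)[OF i] r by (simp add: ln_realpow ln_div)
    moreover have "ln (\<rho> * a i / r) \<le> ln (R\<^sup>2 / r / r)"
      using \<rho>a[OF i] \<rho> u(3)[OF i] r by (intro ln_mono divide_right_mono) auto
    ultimately show "- (4 * L) \<le> ln ((r / \<rho>)\<^sup>2 * (1 / a i)\<^sup>2)" using lnR by simp
  qed
  finally have det0: "- ln ((det (r \<cdot>\<^sub>m B'))\<^sup>2) \<le> 4 * d * L" by simp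
  obtain D where D: "D \<in> carrier_mat d d" "det D \<noteq> 0" "D * scale_dep_matrix d r x n = B'"
    "frob d D - ln ((det D)\<^sup>2) \<le> frob d (r \<cdot>\<^sub>m B') - ln ((det (r \<cdot>\<^sub>m B'))\<^sup>2)"
    using potential_scale_dep_matrix[OF d r x B' B'x order_refl] by blast
  \<comment> \<open>The potential is at least ||D||_F^2 / 2 and starts at no more than d + 4 d L.
    Doubling gives the bound, and rounding 2 up to 8 yields the constant sqrt 8.\<close>
  have "frob d D \<le> 2 * d + 8 * d * L"
    using D(4) ln_det_le_half_frob[OF D(1,2)] frob0 det0 by simp
  also have "\<dots> \<le> 8 * (d * (L + 1))" by (simp add: algebra_simps)
  finally have frobD: "frob d D \<le> 8 * (d * (L + 1))" .
  define \<alpha> where "\<alpha> = sqrt 8 * sqrt (real d * (L + 1))"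
  have \<alpha>: "\<alpha> > 0" "\<alpha>\<^sup>2 = 8 * (d * (L + 1))" using d L0 by (auto simp: \<alpha>_def power_mult_distrib)
  let ?A = "scale_dep_matrix d r x n"
  have "E n = mat_ellipsoid d ?A" using run scale_dep_run_iff[OF d r x] by simp
  moreover have "v \<in> dilate \<alpha> Estar" if v: "v \<in> mat_ellipsoid d ?A" for v
  proof -
    have vc: "v \<in> carrier_vec d" and Av: "enorm (?A *\<^sub>v v) \<le> 1" using v by (auto simp: mat_ellipsoid_def)
    have Ac: "?A *\<^sub>v v \<in> carrier_vec d" using scale_dep_matrix_carrier vc by (rule mult_mat_vec_carrier)
    have "(enorm (B' *\<^sub>v v))\<^sup>2 = (enorm (D *\<^sub>v (?A *\<^sub>v v)))\<^sup>2"
      using assoc_mult_mat_vec[OF D(1) scale_dep_matrix_carrier vc, of r x n] D(3) by simp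
    also have "\<dots> \<le> frob d D * (enorm (?A *\<^sub>v v))\<^sup>2" by (rule enorm_mult_mat_vec_le[OF D(1) Ac])
    also have "\<dots> \<le> frob d D * 1"
      using Av by (intro mult_left_mono frob_ge_0 power_le_one enorm_ge_0)
    also have "\<dots> \<le> \<alpha>\<^sup>2" using frobD \<alpha> by simp
    finally have "enorm (B' *\<^sub>v v) \<le> \<alpha>" by (rule power2_le_imp_le) (use \<alpha> in auto)
    then have "enorm (B *\<^sub>v v) \<le> \<rho> * \<alpha>"
      using \<rho> B vc by (simp add: B'_def enorm_smult_mat_mult_vec[of _ d] field_simps)
    \<comment> \<open>Passing from the shrunken ellipsoid back to \<open>Estar\<close> costs
      nothing, as \<rho> <= 1.\<close>
    also have "\<dots> \<le> \<alpha>" using \<rho>_le_1 \<alpha> mult_right_mono[of \<rho> 1 \<alpha>] by simp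
    finally have "(1 / \<alpha>) \<cdot>\<^sub>v v \<in> Estar"
      using vc B \<alpha> by (simp add: Estar mat_ellipsoid_def mult_mat_vec[of _ d d] enorm_smult)
    moreover have "v = \<alpha> \<cdot>\<^sub>v ((1 / \<alpha>) \<cdot>\<^sub>v v)" using \<alpha> by (simp add: smult_smult_assoc)
    ultimately show ?thesis unfolding dilate_def by (rule rev_image_eqI)
  qed
  ultimately show ?thesis by (auto simp: \<alpha>_def L_def)
qed

section \<open>Cost of the matrix program\<close>

text \<open>A superset of everything the program touches. It depends on \<open>d\<close> alone,
  which is why the space bound does not grow with the number of points.\<close>

definition work_cells :: "nat \<Rightarrow> cell set" where
  "work_cells d = {''A''} \<times> {..<d * d} \<union> {''x'', ''y'', ''w''} \<times> {..<d} \<union> {''s'', ''c'', ''r''} \<times> {0}"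

lemma entry_less: "i < d \<Longrightarrow> j < d \<Longrightarrow> i * d + j < d * d" for i j d :: nat
proof -
  assume "i < d" "j < d"
  then have "i * d + j < Suc i * d" by simp
  also have "\<dots> \<le> d * d" using \<open>i < d\<close> by (intro mult_le_mono1) simp
  finally show ?thesis .
qed

text \<open>Uniqueness of division with remainder: row-major addresses determine row and column, so
  a write to one entry leaves the others alone.\<close>

lemma entry_eq_iff:
  fixes d :: nat
  assumes "j < d" "j' < d"
  shows "i * d + j = i' * d + j' \<longleftrightarrow> i = i' \<and> j = j'"
proof
  assume eq: "i * d + j = i' * d + j'"
  have "(i * d + j) div d = i" "(i' * d + j') div d = i'" using assms by simp_all
  then show "i = i' \<and> j = j'" using eq by simp
qed simp

lemma mem_work_cells [simp]:
  "i < d \<Longrightarrow> j < d \<Longrightarrow> (''A'', i * d + j) \<in> work_cells d"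
  "i < d \<Longrightarrow> (''x'', i) \<in> work_cells d" "i < d \<Longrightarrow> (''y'', i) \<in> work_cells d"
  "i < d \<Longrightarrow> (''w'', i) \<in> work_cells d" "(''s'', 0) \<in> work_cells d" "(''c'', 0) \<in> work_cells d"
  "(''r'', 0) \<in> work_cells d"
  by (auto simp: work_cells_def entry_less)

lemma finite_work_cells: "finite (work_cells d)"
  by (simp add: work_cells_def)

lemma card_work_cells: "0 < d \<Longrightarrow> card (work_cells d) \<le> 7 * d * d"
proof -
  assume d: "0 < d"
  have "card (work_cells d) \<le> card ({''A''} \<times> {..<d * d}) + card ({''x'', ''y'', ''w''} \<times> {..<d})
      + card ({''s'', ''c'', ''r''} \<times> {0::nat})"
    unfolding work_cells_def by (meson card_Un_le add_le_mono order_refl order_trans)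
  also have "\<dots> = d * d + 3 * d + 3" by (simp add: card_cartesian_product)
  \<comment> \<open>For d >= 1 the terms 3 d and 3 are at most 3 d^2 each.\<close>
  also have "\<dots> \<le> 7 * d * d"
  proof -
    have "d \<le> d * d" "1 \<le> d" using d by simp_all
    then show ?thesis by linarith
  qed
  finally show ?thesis .
qed

section \<open>Hoare triples that also bound steps and memory cells\<close>

type_synonym assertion = "(string \<Rightarrow> nat) \<Rightarrow> (cell \<Rightarrow> real) \<Rightarrow> real list \<Rightarrow> bool"

text \<open>Assertions see indices, memory and tape but not the counters, so charging a cost
  preserves them. Steps are bounded as an increase and new cells by a fixed set, so step bounds add
  up under composition while the cell set stays the same.\<close>

definition triple :: "nat \<Rightarrow> assertion \<Rightarrow> com \<Rightarrow> nat \<Rightarrow> assertion \<Rightarrow> bool" where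
  "triple d P c k Q \<longleftrightarrow> (\<forall>s. P (idx s) (mem s) (tape s) \<longrightarrow>
     Q (idx (exec c s)) (mem (exec c s)) (tape (exec c s)) \<and>
     steps (exec c s) \<le> steps s + k \<and> cells (exec c s) \<subseteq> cells s \<union> work_cells d)"

lemma charge_simps [simp]:
  "idx (charge k C s) = idx s" "mem (charge k C s) = mem s" "tape (charge k C s) = tape s"
  "steps (charge k C s) = steps s + k" "cells (charge k C s) = cells s \<union> C"
  by (simp_all add: charge_def)

lemma triple_Skip: "1 \<le> k \<Longrightarrow> triple d P Skip k P"
  by (simp add: triple_def)

lemma triple_Seq:
  assumes "triple d P c k Q" "triple d Q c' k' S" "k + k' \<le> l"
  shows "triple d P (c ;; c') l S"
  unfolding triple_def
proof (intro allI impI)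
  fix s :: ram assume "P (idx s) (mem s) (tape s)"
  then have 1: "Q (idx (exec c s)) (mem (exec c s)) (tape (exec c s))"
    "steps (exec c s) \<le> steps s + k" "cells (exec c s) \<subseteq> cells s \<union> work_cells d"
    using assms(1) by (auto simp: triple_def)
  then have "S (idx (exec c' (exec c s))) (mem (exec c' (exec c s))) (tape (exec c' (exec c s)))"
    "steps (exec c' (exec c s)) \<le> steps (exec c s) + k'"
    "cells (exec c' (exec c s)) \<subseteq> cells (exec c s) \<union> work_cells d"
    using assms(2) by (auto simp: triple_def)
  then show "S (idx (exec (c ;; c') s)) (mem (exec (c ;; c') s)) (tape (exec (c ;; c') s)) \<and>
      steps (exec (c ;; c') s) \<le> steps s + l \<and> cells (exec (c ;; c') s) \<subseteq> cells s \<union> work_cells d"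
    using 1 assms(3) by auto
qed

lemma triple_Assign:
  assumes "\<And>s. P (idx s) (mem s) (tape s) \<Longrightarrow>
      Q (idx s) ((mem s)((a, ival e s) := rval t s)) (tape s) \<and>
      insert (a, ival e s) (rcells t s) \<subseteq> work_cells d"
    and "icost e + rcost t + 1 \<le> k"
  shows "triple d P (Assign a e t) k Q"
  using assms by (auto simp: triple_def)

lemma triple_Read:
  assumes "\<And>s. P (idx s) (mem s) (tape s) \<Longrightarrow>
      Q (idx s) ((mem s)((a, ival e s) := hd (tape s))) (tl (tape s)) \<and> (a, ival e s) \<in> work_cells d"
    and "icost e + 1 \<le> k"
  shows "triple d P (Read a e) k Q"
  using assms by (auto simp: triple_def)

text \<open>\<open>b\<close> is a fixed truth value: the precondition already decides the
  comparison, so only the branch actually taken has to be verified.\<close>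

lemma triple_IfLe:
  assumes "\<And>s. P (idx s) (mem s) (tape s) \<Longrightarrow>
      (rval t s \<le> rval t' s \<longleftrightarrow> b) \<and> rcells t s \<union> rcells t' s \<subseteq> work_cells d"
    and "triple d P (if b then c else c') k Q" and "rcost t + rcost t' + 1 + k \<le> l"
  shows "triple d P (IfLe t t' c c') l Q"
  unfolding triple_def
proof (intro allI impI)
  fix s :: ram assume P: "P (idx s) (mem s) (tape s)"
  define s' where "s' = charge (rcost t + rcost t' + 1) (rcells t s \<union> rcells t' s) s"
  have "exec (IfLe t t' c c') s = exec (if b then c else c') s'"
    using assms(1)[OF P] by (simp add: s'_def Let_def)
  moreover have "P (idx s') (mem s') (tape s')" using P by (simp add: s'_def)
  ultimately show "Q (idx (exec (IfLe t t' c c') s)) (mem (exec (IfLe t t' c c') s)) (tape (exec (IfLe t t' c c') s)) \<and>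
      steps (exec (IfLe t t' c c') s) \<le> steps s + l \<and> cells (exec (IfLe t t' c c') s) \<subseteq> cells s \<union> work_cells d"
    using assms(2,3) assms(1)[OF P] unfolding triple_def by (fastforce simp: s'_def)
qed

text \<open>\<open>J k\<close> holds before iteration \<open>k\<close>. The loop sets its counter
  before each round and leaves the last value behind, so the invariant has to survive any assignment
  to it; \<open>K + 1\<close> includes the step charged per iteration.\<close>

lemma triple_For:
  assumes body: "\<And>k. k < N \<Longrightarrow> triple d (\<lambda>I M T. I i = k \<and> J k I M T) c K (J (Suc k))"
    and stable: "\<And>k m I M T. J k I M T \<Longrightarrow> J k (I(i := m)) M T"
    and bound: "\<And>s. J 0 (idx s) (mem s) (tape s) \<Longrightarrow> ival e s = N"
    and cost: "icost e + 1 + N * (K + 1) \<le> l"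
  shows "triple d (J 0) (For i e c) l (J N)"
  unfolding triple_def
proof (intro allI impI)
  fix s :: ram assume J: "J 0 (idx s) (mem s) (tape s)"
  define step where "step k s' = exec c (charge 1 {} (s'\<lparr>idx := (idx s')(i := k)\<rparr>))" for k s'
  define s0 where "s0 = charge (icost e + 1) {} s"
  have "J m (idx (fold step [0..<m] s0)) (mem (fold step [0..<m] s0)) (tape (fold step [0..<m] s0)) \<and>
      steps (fold step [0..<m] s0) \<le> steps s0 + m * (K + 1) \<and>
      cells (fold step [0..<m] s0) \<subseteq> cells s0 \<union> work_cells d" if "m \<le> N" for m
    using that
  proof (induction m)
    case 0
    then show ?case using J by (simp add: s0_def)
  next
    case (Suc m)
    define s1 where "s1 = fold step [0..<m] s0"
    define s2 where "s2 = charge 1 {} (s1\<lparr>idx := (idx s1)(i := m)\<rparr>)"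
    have s1: "J m (idx s1) (mem s1) (tape s1)" "steps s1 \<le> steps s0 + m * (K + 1)"
      "cells s1 \<subseteq> cells s0 \<union> work_cells d"
      using Suc by (auto simp: s1_def)
    have s2: "idx s2 i = m" "J m (idx s2) (mem s2) (tape s2)" "steps s2 = steps s1 + 1" "cells s2 = cells s1"
      using stable[OF s1(1)] by (simp_all add: s2_def)
    have "J (Suc m) (idx (exec c s2)) (mem (exec c s2)) (tape (exec c s2)) \<and>
        steps (exec c s2) \<le> steps s2 + K \<and> cells (exec c s2) \<subseteq> cells s2 \<union> work_cells d"
      using body[of m] Suc.prems s2(1,2) by (simp add: triple_def)
    moreover have "fold step [0..<Suc m] s0 = exec c s2" by (simp add: s1_def s2_def step_def)
    ultimately show ?case using s1(2,3) s2(3,4) by auto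
  qed
  from this[OF order_refl]
  have "J N (idx (fold step [0..<N] s0)) (mem (fold step [0..<N] s0)) (tape (fold step [0..<N] s0)) \<and>
      steps (fold step [0..<N] s0) \<le> steps s0 + N * (K + 1) \<and>
      cells (fold step [0..<N] s0) \<subseteq> cells s0 \<union> work_cells d" .
  moreover have "exec (For i e c) s = fold step [0..<N] s0"
    by (simp add: bound[OF J] s0_def step_def[abs_def])
  ultimately show "J N (idx (exec (For i e c) s)) (mem (exec (For i e c) s)) (tape (exec (For i e c) s)) \<and>
      steps (exec (For i e c) s) \<le> steps s + l \<and> cells (exec (For i e c) s) \<subseteq> cells s \<union> work_cells d"
    using cost by (auto simp: s0_def)
qed

text \<open>The 2 steps spent on the loop bound are spread over the d >= 1 rounds, giving K + 1 + 2
  per round.\<close>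

lemma triple_For_dim:
  assumes "0 < d"
    and body: "\<And>k. k < d \<Longrightarrow> triple d (\<lambda>I M T. I i = k \<and> J k I M T) c K (J (Suc k))"
    and stable: "\<And>k m I M T. J k I M T \<Longrightarrow> J k (I(i := m)) M T"
    and dim: "\<And>I M T. J 0 I M T \<Longrightarrow> I ''d'' = d"
    and "(K + 3) * d \<le> l"
  shows "triple d (J 0) (For i (IVar ''d'') c) l (J d)"
proof (rule triple_For[OF body stable])
  show "icost (IVar ''d'') + 1 + d * (K + 1) \<le> l" using assms(1,5) by (simp add: algebra_simps)
qed (use dim in auto)

lemma triple_conseq:
  assumes "triple d P c k Q" "\<And>I M T. P' I M T \<Longrightarrow> P I M T" "\<And>I M T. Q I M T \<Longrightarrow> Q' I M T" "k \<le> k'"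
  shows "triple d P' c k' Q'"
  unfolding triple_def
proof (intro allI impI)
  fix s :: ram assume "P' (idx s) (mem s) (tape s)"
  then have "P (idx s) (mem s) (tape s)" by (rule assms(2))
  then show "Q' (idx (exec c s)) (mem (exec c s)) (tape (exec c s)) \<and>
     steps (exec c s) \<le> steps s + k' \<and> cells (exec c s) \<subseteq> cells s \<union> work_cells d"
    using assms(1,3,4) unfolding triple_def by (meson add_left_mono le_trans)
qed

section \<open>Correctness and running time of the matrix program\<close>

lemma triple_init_prog:
  assumes d: "0 < d"
  shows "triple d (\<lambda>I M T. I ''d'' = d \<and> M (''r'', 0) = r) init_prog (100 * d * d)
    (\<lambda>I M T. I ''d'' = d \<and> (\<forall>i<d. \<forall>j<d. M (''A'', i * d + j) = (if i = j then 1 / r else 0)))"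
proof -
  define J where "J m I M T \<longleftrightarrow> I ''d'' = d \<and> M (''r'', 0) = r \<and> (\<forall>i<m. \<forall>j<d. M (''A'', i * d + j) = 0)"
    for m and I :: "string \<Rightarrow> nat" and M :: "cell \<Rightarrow> real" and T :: "real list"
  \<comment> \<open>The inner invariant records the outer counter, because the row being written is
    addressed through \<open>''i''\<close>.\<close>
  define J' where "J' i m I M T \<longleftrightarrow> I ''i'' = i \<and> J i I M T \<and> (\<forall>j<m. M (''A'', i * d + j) = 0)"
    for i m and I :: "string \<Rightarrow> nat" and M :: "cell \<Rightarrow> real" and T :: "real list"
  define Z where "Z m I M T \<longleftrightarrow> I ''d'' = d \<and> M (''r'', 0) = r \<and>
      (\<forall>i<d. \<forall>j<d. M (''A'', i * d + j) = (if i = j \<and> i < m then 1 / r else 0))"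
    for m and I :: "string \<Rightarrow> nat" and M :: "cell \<Rightarrow> real" and T :: "real list"
  have "triple d (J' i 0) (for_j (Assign ''A'' entryA (Const 0))) (12 * d) (J' i d)" if i: "i < d" for i
  proof (rule triple_For_dim[OF d])
    show "triple d (\<lambda>I M T. I ''j'' = k \<and> J' i k I M T) (Assign ''A'' entryA (Const 0)) 7 (J' i (Suc k))" if "k < d" for k
      by (rule triple_Assign) (use i that in \<open>auto simp: J'_def J_def less_Suc_eq\<close>)
  qed (use d in \<open>auto simp: J'_def J_def\<close>)
  then have "triple d (\<lambda>I M T. I ''i'' = i \<and> J i I M T) (for_j (Assign ''A'' entryA (Const 0))) (12 * d) (J (Suc i))"
    if "i < d" for i
    by (rule triple_conseq) (use that in \<open>auto simp: J'_def J_def less_Suc_eq\<close>)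
  then have 1: "triple d (J 0) (for_i (for_j (Assign ''A'' entryA (Const 0)))) (20 * d * d) (J d)"
    by (rule triple_For_dim[OF d]) (use d in \<open>auto simp: J_def\<close>)
  let ?asg = "Assign ''A'' (IAdd (IMul (IVar ''i'') (IVar ''d'')) (IVar ''i'')) (Div (Const 1) (scalar ''r''))"
  have "triple d (\<lambda>I M T. I ''i'' = i \<and> Z i I M T) ?asg 10 (Z (Suc i))" if "i < d" for i
    by (rule triple_Assign) (use that in \<open>auto simp: Z_def less_Suc_eq entry_eq_iff\<close>)
  then have "triple d (Z 0) (for_i ?asg) (20 * d * d) (Z d)"
    by (rule triple_For_dim[OF d]) (use d in \<open>auto simp: Z_def\<close>)
  then have 2: "triple d (J d) (for_i ?asg) (20 * d * d) (Z d)"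
    by (rule triple_conseq) (auto simp: J_def Z_def)
  have "triple d (J 0) init_prog (40 * d * d) (Z d)"
    unfolding init_prog_def by (rule triple_Seq[OF 1 2]) simp
  then show ?thesis by (rule triple_conseq) (auto simp: J_def Z_def)
qed

text \<open>The rank-one product is bracketed as y (y^T A): two matrix-vector products and one outer
  product take O(d^2) steps, where a direct product of matrices would take order d^3. The result is
  stated for plain functions and matched with \<open>update_matrix\<close> separately.\<close>

lemma triple_update_prog:
  fixes A :: "nat \<Rightarrow> nat \<Rightarrow> real" and v :: "nat \<Rightarrow> real"
  assumes d: "0 < d" and xs: "length xs = d" "\<And>i. i < d \<Longrightarrow> xs ! i = v i"
  defines "y \<equiv> \<lambda>i. \<Sum>j<d. A i j * v j"
  defines "\<sigma> \<equiv> sqrt (\<Sum>i<d. y i * y i)"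
  defines "A' \<equiv> \<lambda>i j. A i j - (1 - 1 / \<sigma>) / (\<sigma> * \<sigma>) * (y i * (\<Sum>k<d. y k * A k j))"
  shows "triple d (\<lambda>I M T. I ''d'' = d \<and> (\<forall>i<d. \<forall>j<d. M (''A'', i * d + j) = A i j) \<and> T = xs) update_prog (500 * d * d)
    (\<lambda>I M T. I ''d'' = d \<and> (\<forall>i<d. \<forall>j<d. M (''A'', i * d + j) = (if \<sigma> \<le> 1 then A i j else A' i j)))"
    (is "triple d ?P _ _ ?Q")
proof -
  define base where "base I M \<longleftrightarrow> I ''d'' = d \<and> (\<forall>i<d. \<forall>j<d. M (''A'', i * d + j) = A i j)"
    for I :: "string \<Rightarrow> nat" and M :: "cell \<Rightarrow> real"
  define J1 where "J1 m I M T \<longleftrightarrow> base I M \<and> T = drop m xs \<and> (\<forall>i<m. M (''x'', i) = v i)"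
    for m and I :: "string \<Rightarrow> nat" and M :: "cell \<Rightarrow> real" and T :: "real list"
  have "triple d (\<lambda>I M T. I ''i'' = i \<and> J1 i I M T) (Read ''x'' (IVar ''i'')) 5 (J1 (Suc i))" if "i < d" for i
    by (rule triple_Read) (use that xs in \<open>auto simp: J1_def base_def less_Suc_eq hd_drop_conv_nth drop_Suc tl_drop\<close>)
  then have 1: "triple d (J1 0) (for_i (Read ''x'' (IVar ''i''))) (10 * d * d) (J1 d)"
    by (rule triple_For_dim[OF d]) (use d in \<open>auto simp: J1_def base_def\<close>)

  define J2 where "J2 m I M T \<longleftrightarrow> base I M \<and> (\<forall>i<d. M (''x'', i) = v i) \<and> (\<forall>i<m. M (''y'', i) = y i)"
    for m and I :: "string \<Rightarrow> nat" and M :: "cell \<Rightarrow> real" and T :: "real list"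
  define K2 where "K2 i m I M T \<longleftrightarrow> I ''i'' = i \<and> J2 i I M T \<and> M (''y'', i) = (\<Sum>j<m. A i j * v j)"
    for i m and I :: "string \<Rightarrow> nat" and M :: "cell \<Rightarrow> real" and T :: "real list"
  let ?y = "Assign ''y'' (IVar ''i'') (Add (Cell ''y'' (IVar ''i'')) (Mul (Cell ''A'' entryA) (Cell ''x'' (IVar ''j''))))"
  have inner2: "triple d (K2 i 0) (for_j ?y) (33 * d) (K2 i d)" if i: "i < d" for i
  proof (rule triple_For_dim[OF d])
    show "triple d (\<lambda>I M T. I ''j'' = k \<and> K2 i k I M T) ?y 30 (K2 i (Suc k))" if "k < d" for k
      by (rule triple_Assign) (use i that in \<open>auto simp: K2_def J2_def base_def\<close>)
  qed (auto simp: K2_def J2_def base_def)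
  have "triple d (\<lambda>I M T. I ''i'' = i \<and> J2 i I M T) (Assign ''y'' (IVar ''i'') (Const 0) ;; for_j ?y) (43 * d) (J2 (Suc i))"
    if i: "i < d" for i
  proof -
    have "triple d (\<lambda>I M T. I ''i'' = i \<and> J2 i I M T) (Assign ''y'' (IVar ''i'') (Const 0)) (10 * d) (K2 i 0)"
      by (rule triple_Assign) (use i d in \<open>auto simp: K2_def J2_def base_def\<close>)
    then have "triple d (\<lambda>I M T. I ''i'' = i \<and> J2 i I M T) (Assign ''y'' (IVar ''i'') (Const 0) ;; for_j ?y) (43 * d) (K2 i d)"
      by (rule triple_Seq[OF _ inner2[OF i]]) simp
    then show ?thesis
      by (rule triple_conseq) (auto simp: K2_def J2_def y_def less_Suc_eq)
  qed
  then have "triple d (J2 0) (for_i (Assign ''y'' (IVar ''i'') (Const 0) ;; for_j ?y)) (60 * d * d) (J2 d)"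
    by (rule triple_For_dim[OF d]) (use d in \<open>auto simp: J2_def base_def\<close>)
  then have 2: "triple d (J1 d) (for_i (Assign ''y'' (IVar ''i'') (Const 0) ;; for_j ?y)) (60 * d * d) (J2 d)"
    by (rule triple_conseq) (auto simp: J1_def J2_def)

  define J3 where "J3 m I M T \<longleftrightarrow> base I M \<and> (\<forall>i<d. M (''y'', i) = y i) \<and> M (''s'', 0) = (\<Sum>i<m. y i * y i)"
    for m and I :: "string \<Rightarrow> nat" and M :: "cell \<Rightarrow> real" and T :: "real list"
  have 3: "triple d (J2 d) (Assign ''s'' (IConst 0) (Const 0)) (10 * d * d) (J3 0)"
  proof (rule triple_Assign)
    show "icost (IConst 0) + rcost (Const 0) + 1 \<le> 10 * d * d" using d by (cases d) auto
  qed (auto simp: J2_def J3_def base_def)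
  let ?s = "Assign ''s'' (IConst 0) (Add (scalar ''s'') (Mul (Cell ''y'' (IVar ''i'')) (Cell ''y'' (IVar ''i''))))"
  have "triple d (\<lambda>I M T. I ''i'' = i \<and> J3 i I M T) ?s 30 (J3 (Suc i))" if "i < d" for i
    by (rule triple_Assign) (use that in \<open>auto simp: J3_def base_def\<close>)
  then have 4: "triple d (J3 0) (for_i ?s) (40 * d * d) (J3 d)"
    by (rule triple_For_dim[OF d]) (use d in \<open>auto simp: J3_def base_def\<close>)

  define S where "S I M T \<longleftrightarrow> base I M \<and> (\<forall>i<d. M (''y'', i) = y i) \<and> M (''s'', 0) = \<sigma>"
    for I :: "string \<Rightarrow> nat" and M :: "cell \<Rightarrow> real" and T :: "real list"
  have 5: "triple d (J3 d) (Assign ''s'' (IConst 0) (Sqrt (scalar ''s''))) (10 * d * d) S"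
  proof (rule triple_Assign)
    show "icost (IConst 0) + rcost (Sqrt (scalar ''s'')) + 1 \<le> 10 * d * d" using d by (cases d) auto
  qed (auto simp: J3_def S_def base_def \<sigma>_def)

  define w where "w j = (\<Sum>i<d. y i * A i j)" for j
  define c where "c = (1 - 1 / \<sigma>) / (\<sigma> * \<sigma>)"
  define J4 where "J4 m I M T \<longleftrightarrow> S I M T \<and> (\<forall>j<m. M (''w'', j) = w j)"
    for m and I :: "string \<Rightarrow> nat" and M :: "cell \<Rightarrow> real" and T :: "real list"
  define K4 where "K4 j m I M T \<longleftrightarrow> I ''j'' = j \<and> J4 j I M T \<and> M (''w'', j) = (\<Sum>i<m. y i * A i j)"
    for j m and I :: "string \<Rightarrow> nat" and M :: "cell \<Rightarrow> real" and T :: "real list"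
  let ?w = "Assign ''w'' (IVar ''j'') (Add (Cell ''w'' (IVar ''j'')) (Mul (Cell ''y'' (IVar ''i'')) (Cell ''A'' entryA)))"
  have inner4: "triple d (K4 j 0) (for_i ?w) (33 * d) (K4 j d)" if j: "j < d" for j
  proof (rule triple_For_dim[OF d])
    show "triple d (\<lambda>I M T. I ''i'' = k \<and> K4 j k I M T) ?w 30 (K4 j (Suc k))" if "k < d" for k
      by (rule triple_Assign) (use j that in \<open>auto simp: K4_def J4_def S_def base_def\<close>)
  qed (auto simp: K4_def J4_def S_def base_def)
  have "triple d (\<lambda>I M T. I ''j'' = j \<and> J4 j I M T) (Assign ''w'' (IVar ''j'') (Const 0) ;; for_i ?w) (43 * d) (J4 (Suc j))"
    if j: "j < d" for j
  proof -
    have "triple d (\<lambda>I M T. I ''j'' = j \<and> J4 j I M T) (Assign ''w'' (IVar ''j'') (Const 0)) (10 * d) (K4 j 0)"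
      by (rule triple_Assign) (use j d in \<open>auto simp: K4_def J4_def S_def base_def\<close>)
    then have "triple d (\<lambda>I M T. I ''j'' = j \<and> J4 j I M T) (Assign ''w'' (IVar ''j'') (Const 0) ;; for_i ?w) (43 * d) (K4 j d)"
      by (rule triple_Seq[OF _ inner4[OF j]]) simp
    then show ?thesis
      by (rule triple_conseq) (auto simp: K4_def J4_def w_def less_Suc_eq)
  qed
  then have "triple d (J4 0) (for_j (Assign ''w'' (IVar ''j'') (Const 0) ;; for_i ?w)) (60 * d * d) (J4 d)"
    by (rule triple_For_dim[OF d]) (use d in \<open>auto simp: J4_def S_def base_def\<close>)
  then have 6: "triple d S (for_j (Assign ''w'' (IVar ''j'') (Const 0) ;; for_i ?w)) (60 * d * d) (J4 d)"
    by (rule triple_conseq) (auto simp: J4_def)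

  \<comment> \<open>\<open>base\<close> is dropped because \<open>A\<close> is now overwritten in
    place, which is safe since \<open>y\<close> and \<open>w\<close> were computed from the old
    entries.\<close>
  define J5 where "J5 m I M T \<longleftrightarrow> I ''d'' = d \<and> (\<forall>i<d. M (''y'', i) = y i) \<and> (\<forall>j<d. M (''w'', j) = w j) \<and>
      M (''c'', 0) = c \<and> (\<forall>i<d. \<forall>j<d. M (''A'', i * d + j) = (if i < m then A' i j else A i j))"
    for m and I :: "string \<Rightarrow> nat" and M :: "cell \<Rightarrow> real" and T :: "real list"
  define K5 where "K5 i m I M T \<longleftrightarrow> I ''i'' = i \<and> I ''d'' = d \<and> (\<forall>i<d. M (''y'', i) = y i) \<and> (\<forall>j<d. M (''w'', j) = w j) \<and>
      M (''c'', 0) = c \<and> (\<forall>i'<d. \<forall>j<d. M (''A'', i' * d + j) = (if i' < i \<or> i' = i \<and> j < m then A' i' j else A i' j))"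
    for i m and I :: "string \<Rightarrow> nat" and M :: "cell \<Rightarrow> real" and T :: "real list"
  let ?c = "Assign ''c'' (IConst 0) (Div (Sub (Const 1) (Div (Const 1) (scalar ''s''))) (Mul (scalar ''s'') (scalar ''s'')))"
  have 7: "triple d (J4 d) ?c (20 * d * d) (J5 0)"
  proof (rule triple_Assign)
    show "icost (IConst 0) + rcost (Div (Sub (Const 1) (Div (Const 1) (scalar ''s'')))
        (Mul (scalar ''s'') (scalar ''s''))) + 1 \<le> 20 * d * d" using d by (cases d) auto
  qed (auto simp: J4_def J5_def S_def base_def c_def)
  let ?A = "Assign ''A'' entryA (Sub (Cell ''A'' entryA) (Mul (scalar ''c'') (Mul (Cell ''y'' (IVar ''i'')) (Cell ''w'' (IVar ''j'')))))"
  have A': "A' i j = A i j - c * (y i * w j)" for i j by (simp add: A'_def c_def w_def)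
  have inner5: "triple d (K5 i 0) (for_j ?A) (53 * d) (K5 i d)" if i: "i < d" for i
  proof (rule triple_For_dim[OF d])
    show "triple d (\<lambda>I M T. I ''j'' = k \<and> K5 i k I M T) ?A 50 (K5 i (Suc k))" if "k < d" for k
      by (rule triple_Assign) (use i that in \<open>auto simp: K5_def A' less_Suc_eq entry_eq_iff\<close>)
  qed (auto simp: K5_def)
  have "triple d (\<lambda>I M T. I ''i'' = i \<and> J5 i I M T) (for_j ?A) (53 * d) (J5 (Suc i))" if i: "i < d" for i
    by (rule triple_conseq[OF inner5[OF i]]) (auto simp: J5_def K5_def less_Suc_eq)
  then have 8: "triple d (J5 0) (for_i (for_j ?A)) (70 * d * d) (J5 d)"
    by (rule triple_For_dim[OF d]) (use d in \<open>auto simp: J5_def\<close>)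

  have "triple d S (if \<sigma> \<le> 1 then Skip else
      (for_j (Assign ''w'' (IVar ''j'') (Const 0) ;; for_i ?w)) ;; ?c ;; for_i (for_j ?A)) (150 * d * d) ?Q"
  proof (cases "\<sigma> \<le> 1")
    case True
    have "triple d S Skip 1 S" by (rule triple_Skip) simp
    then have "triple d S Skip (150 * d * d) ?Q"
      by (rule triple_conseq) (use True d in \<open>auto simp: S_def base_def\<close>)
    then show ?thesis using True by simp
  next
    case False
    have "triple d (J4 d) (?c ;; for_i (for_j ?A)) (90 * d * d) (J5 d)"
      by (rule triple_Seq[OF 7 8]) simp
    then have "triple d S ((for_j (Assign ''w'' (IVar ''j'') (Const 0) ;; for_i ?w)) ;; ?c ;; for_i (for_j ?A)) (150 * d * d) (J5 d)"
      by (rule triple_Seq[OF 6]) simp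
    then have "triple d S ((for_j (Assign ''w'' (IVar ''j'') (Const 0) ;; for_i ?w)) ;; ?c ;; for_i (for_j ?A)) (150 * d * d) ?Q"
      by (rule triple_conseq) (use False in \<open>auto simp: J5_def\<close>)
    then show ?thesis using False by simp
  qed
  then have 9: "triple d S (IfLe (scalar ''s'') (Const 1) Skip
      ((for_j (Assign ''w'' (IVar ''j'') (Const 0) ;; for_i ?w)) ;; ?c ;; for_i (for_j ?A))) (160 * d * d) ?Q"
  proof (rule triple_IfLe[rotated])
    show "rcost (scalar ''s'') + rcost (Const 1) + 1 + 150 * d * d \<le> 160 * d * d" using d by (cases d) (auto simp: algebra_simps)
  qed (auto simp: S_def)
  have "triple d (J1 0) update_prog (500 * d * d) ?Q"
    unfolding update_prog_def
    by (rule triple_Seq[OF 1 triple_Seq[OF 2 triple_Seq[OF 3 triple_Seq[OF 4 triple_Seq[OF 5 9]]]],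
          OF order_refl order_refl order_refl order_refl]) simp
  then show ?thesis by (rule triple_conseq) (auto simp: J1_def base_def)
qed

text \<open>Associativity, (y y^T) A = y (y^T A), connects the matrix formula with the order in
  which the program computes.\<close>

lemma update_matrix_index:
  assumes A: "A \<in> carrier_mat d d" and v: "v \<in> carrier_vec d" and ij: "i < d" "j < d"
  defines "y \<equiv> \<lambda>i. \<Sum>j<d. A $$ (i, j) * v $ j"
  defines "\<sigma> \<equiv> sqrt (\<Sum>i<d. y i * y i)"
  shows "update_matrix d A v $$ (i, j) = (if \<sigma> \<le> 1 then A $$ (i, j) else
    A $$ (i, j) - (1 - 1 / \<sigma>) / (\<sigma> * \<sigma>) * (y i * (\<Sum>k<d. y k * A $$ (k, j))))"
proof -
  define u where "u = A *\<^sub>v v"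
  have u: "u \<in> carrier_vec d" using A v by (simp add: u_def)
  have uy: "u $ i = y i" if "i < d" for i
    unfolding u_def y_def by (rule mult_mat_vec_index[OF A v that])
  have \<sigma>: "enorm u = \<sigma>"
    unfolding enorm_def \<sigma>_def scalar_prod_eq_sum[OF u] using uy by simp
  let ?M = "1\<^sub>m d - (1 - 1 / \<sigma>) \<cdot>\<^sub>m mat d d (\<lambda>(i, j). u $ i * u $ j / \<sigma>\<^sup>2)"
  have M: "?M \<in> carrier_mat d d" by (intro minus_carrier_mat smult_carrier_mat mat_carrier)
  define q where "q = (1 - 1 / \<sigma>) / (\<sigma> * \<sigma>) * y i"
  have "(?M * A) $$ (i, j) = (\<Sum>k<d. (if k = i then A $$ (i, j) else 0) - q * (y k * A $$ (k, j)))"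
    unfolding mult_mat_index[OF M A ij] using ij
    by (intro sum.cong) (auto simp: uy q_def left_diff_distrib power2_eq_square)
  also have "\<dots> = A $$ (i, j) - q * (\<Sum>k<d. y k * A $$ (k, j))"
    using ij by (simp add: sum_subtractf flip: sum_distrib_left)
  also have "\<dots> = A $$ (i, j) - (1 - 1 / \<sigma>) / (\<sigma> * \<sigma>) * (y i * (\<Sum>k<d. y k * A $$ (k, j)))"
    by (simp add: q_def)
  finally show ?thesis by (simp add: update_matrix_def Let_def \<sigma> flip: u_def)
qed

text \<open>Induction over the stream. The precondition of an update speaks only of the dimension,
  the matrix and the tape, so whatever earlier rounds left in the other cells does no harm.\<close>

lemma run_stream_correct:
  assumes d: "0 < d" and x: "\<forall>t\<in>{1..n}. x t \<in> carrier_vec d"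
  shows "idx (run_stream d r x n) ''d'' = d \<and>
    stored_matrix d (run_stream d r x n) = scale_dep_matrix d r x n \<and>
    steps (run_stream d r x n) \<le> (100 + 500 * n) * d * d \<and>
    cells (run_stream d r x n) \<subseteq> work_cells d"
  using x
proof (induction n)
  case 0
  have "idx (start d r) ''d'' = d \<and> mem (start d r) (''r'', 0) = r" by (simp add: start_def)
  then have "(idx (exec init_prog (start d r)) ''d'' = d \<and>
      (\<forall>i<d. \<forall>j<d. mem (exec init_prog (start d r)) (''A'', i * d + j) = (if i = j then 1 / r else 0))) \<and>
      steps (exec init_prog (start d r)) \<le> steps (start d r) + 100 * d * d \<and>
      cells (exec init_prog (start d r)) \<subseteq> cells (start d r) \<union> work_cells d"
    using triple_init_prog[OF d, of r] unfolding triple_def by blast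
  then show ?case by (auto simp: run_stream_def stored_matrix_def start_def intro!: eq_matI)
next
  case (Suc n)
  define s where "s = run_stream d r x n"
  define s' where "s' = s\<lparr>tape := list_of_vec (x (Suc n))\<rparr>"
  define A where "A = scale_dep_matrix d r x n"
  have A: "A \<in> carrier_mat d d" by (simp add: A_def scale_dep_matrix_carrier)
  have v: "x (Suc n) \<in> carrier_vec d" using Suc.prems by simp
  have s: "idx s ''d'' = d" "stored_matrix d s = A" "steps s \<le> (100 + 500 * n) * d * d" "cells s \<subseteq> work_cells d"
    using Suc by (auto simp: s_def A_def)
  have run: "run_stream d r x (Suc n) = exec update_prog s'"
    by (simp add: run_stream_def s_def s'_def)
  have "mem s (''A'', i * d + j) = A $$ (i, j)" if "i < d" "j < d" for i j
    using that by (simp add: stored_matrix_def flip: s(2))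
  then have pre: "idx s' ''d'' = d \<and> (\<forall>i<d. \<forall>j<d. mem s' (''A'', i * d + j) = A $$ (i, j)) \<and>
      tape s' = list_of_vec (x (Suc n))"
    using s(1) by (simp add: s'_def)
  have len: "length (list_of_vec (x (Suc n))) = d" using v by simp
  have nth: "list_of_vec (x (Suc n)) ! i = x (Suc n) $ i" if "i < d" for i
    using v that by (simp add: list_of_vec_index)
  have post: "idx (exec update_prog s') ''d'' = d"
      "\<forall>i<d. \<forall>j<d. mem (exec update_prog s') (''A'', i * d + j) = update_matrix d A (x (Suc n)) $$ (i, j)"
      "steps (exec update_prog s') \<le> steps s' + 500 * d * d"
      "cells (exec update_prog s') \<subseteq> cells s' \<union> work_cells d"
    using triple_update_prog[OF d len nth, of "\<lambda>i j. A $$ (i, j)"] pre update_matrix_index[OF A v]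
    unfolding triple_def by auto
  have "stored_matrix d (exec update_prog s') = update_matrix d A (x (Suc n))"
    using post(2) update_matrix_carrier[OF A, of "x (Suc n)"] by (intro eq_matI) (auto simp: stored_matrix_def)
  moreover have "steps (exec update_prog s') \<le> (100 + 500 * Suc n) * d * d"
    using post(3) s(3) by (simp add: s'_def algebra_simps)
  ultimately show ?case
    unfolding run using post(1,4) s(4) by (auto simp: A_def s'_def)
qed

theorem theorem7:
  shows "(\<exists>C>0. \<forall>d n x r R E Estar \<kappa>.
            0 < d \<and> (\<forall>t\<in>{1..n}. x t \<in> carrier_vec d) \<and>
            0 < r \<and> euclid_ball d r \<subseteq> conv_hull d (\<Union>t\<in>{1..n}. {x t, - x t}) \<and>
            R = Max ((\<lambda>t. enorm (x t)) ` {1..n}) \<and>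
            scale_dep_run d r x n E \<and>
            ellipsoid d Estar \<and> conv_hull d (\<Union>t\<in>{1..n}. {x t, - x t}) \<subseteq> Estar \<and>
            has_aspect_ratio d Estar \<kappa> \<and> \<kappa> \<le> R / r \<longrightarrow>
            E n \<subseteq> dilate (C * sqrt (real d * (ln (R / r) + 1))) Estar) \<and>
         (\<exists>C>0. \<forall>d n x r.
            0 < d \<and> 0 < n \<and> 0 < r \<and> (\<forall>t\<in>{1..n}. x t \<in> carrier_vec d) \<longrightarrow>
            (\<forall>E. scale_dep_run d r x n E \<longleftrightarrow>
                   (\<forall>t\<le>n. E t = mat_ellipsoid d (scale_dep_matrix d r x t))) \<and>
            stored_matrix d (run_stream d r x n) = scale_dep_matrix d r x n \<and>
            real (steps (run_stream d r x n)) \<le> C * real n * (real d)\<^sup>2 \<and>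
            finite (cells (run_stream d r x n)) \<and>
            real (card (cells (run_stream d r x n))) \<le> C * (real d)\<^sup>2)"
proof (rule conjI, goal_cases)
  case 1
  show ?case
  proof (intro exI[of _ "sqrt 8"] conjI allI impI, goal_cases)
    case (2 d n x r R E Estar \<kappa>)
    then show ?case by (elim conjE) (rule scale_dep_run_approximation)
  qed simp
next
  case 2
  have "(\<forall>E. scale_dep_run d r x n E \<longleftrightarrow> (\<forall>t\<le>n. E t = mat_ellipsoid d (scale_dep_matrix d r x t))) \<and>
      stored_matrix d (run_stream d r x n) = scale_dep_matrix d r x n \<and>
      real (steps (run_stream d r x n)) \<le> 600 * real n * (real d)\<^sup>2 \<and>
      finite (cells (run_stream d r x n)) \<and>
      real (card (cells (run_stream d r x n))) \<le> 600 * (real d)\<^sup>2"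
    if d: "0 < d" and n: "0 < n" and r: "0 < r" and x: "\<forall>t\<in>{1..n}. x t \<in> carrier_vec d"
    for d n x and r :: real
  proof (intro conjI allI)
    note run = run_stream_correct[OF d x, of r]
    show "scale_dep_run d r x n E \<longleftrightarrow> (\<forall>t\<le>n. E t = mat_ellipsoid d (scale_dep_matrix d r x t))" for E
      by (rule scale_dep_run_iff[OF d r x])
    show "stored_matrix d (run_stream d r x n) = scale_dep_matrix d r x n"
      using run by blast
    have "steps (run_stream d r x n) \<le> (100 + 500 * n) * d * d"
      using run by blast
    \<comment> \<open>Since n >= 1, the 100 d^2 steps of the initialization can be charged to the
      points: 600 = 100 + 500.\<close>
    also have "\<dots> \<le> (600 * n) * d * d"
      using n by (intro mult_le_mono1) simp
    finally have "real (steps (run_stream d r x n)) \<le> real ((600 * n) * d * d)"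
      by (rule of_nat_mono)
    then show "real (steps (run_stream d r x n)) \<le> 600 * real n * (real d)\<^sup>2"
      by (simp add: power2_eq_square mult.assoc)
    have sub: "cells (run_stream d r x n) \<subseteq> work_cells d" using run by blast
    then show "finite (cells (run_stream d r x n))" using finite_work_cells by (rule finite_subset)
    have "card (cells (run_stream d r x n)) \<le> 7 * d * d"
      using card_mono[OF finite_work_cells sub] card_work_cells[OF d] by (rule order_trans)
    then have "real (card (cells (run_stream d r x n))) \<le> real (7 * d * d)" by (rule of_nat_mono)
    also have "\<dots> \<le> 600 * (real d)\<^sup>2" by (simp add: power2_eq_square)
    finally show "real (card (cells (run_stream d r x n))) \<le> 600 * (real d)\<^sup>2" .
  qed
  then show ?case by (intro exI[of _ 600] conjI allI impI) auto
qed

end
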